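(* As $\theta\to\infty$, $\mathbb P_\theta$ converges weakly to $\mathbb P_\infty$; and as $\theta\to0$, $\mathbb P_\theta$ converges weakly to $\mathbb P_0$.
   Context: Let $d\ge1$. $\Xi$ denotes the space of simple pure point (locally finite, integer-valued) measures on $\mathbb R^d$ with the vague topology. For $\theta\in(0,\infty)$, $\mathbb P_\theta$ is the law on $\Xi$ of $\xi=\sum_{q\in\mathbb Z^d}\delta_{q+\xi_q}$, where $(\xi_q)_{q\in\mathbb Z^d}$ are i.i.d. $\mathbb R^d$-valued with density $N(d,\theta)\exp\{-|x|^\theta\}$ ($N(d,\theta)$ the normalizing constant). $\mathbb P_\infty$ is the law of $\sum_{q\in\mathbb Z^d}\delta_{q+\xi_q}$ with $(\xi_q)$ i.i.d. uniformly distributed on the open unit ball $B(0,1)$, and $\mathbb P_0$ is the law of the Poisson point process on $\mathbb R^d$ with intensity equal to Lebesgue measure. *)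

theory Defs
  imports "HOL-Probability.Probability"
begin

text \<open>Points of R^d are vectors of type real^'n (d = CARD('n) \<ge> 1).
  A simple pure point (locally finite, integer valued) measure is identified with its
  support: a locally finite set of points.\<close>

definition Xi :: "(real^'n) set set" where
  "Xi = {S. \<forall>K. compact K \<longrightarrow> finite (S \<inter> K)}"

definition Cc :: "(real^'n \<Rightarrow> real) set" where
  "Cc = {f. continuous_on UNIV f \<and> bounded {x. f x \<noteq> 0}}"

text \<open>Integral of f against the counting measure of S.\<close>
definition pint :: "(real^'n \<Rightarrow> real) \<Rightarrow> (real^'n) set \<Rightarrow> real" where
  "pint f S = sum f {x\<in>S. f x \<noteq> 0}"

definition vague :: "(real^'n) set topology" where
  "vague = subtopology
     (topology_generated_by {{S. pint f S \<in> U} | f U. f \<in> Cc \<and> open U}) Xi"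

definition XiM :: "(real^'n) set measure" where
  "XiM = sigma Xi {U. openin vague U}"

definition to_Xi :: "(real^'n) set \<Rightarrow> (real^'n) set" where
  "to_Xi S = (if S \<in> Xi then S else {})"

definition lat :: "int^'n \<Rightarrow> real^'n" where
  "lat q = (\<chi> i. of_int (q $ i))"

definition pert_cfg :: "(int^'n \<Rightarrow> real^'n) \<Rightarrow> (real^'n) set" where
  "pert_cfg \<omega> = to_Xi (range (\<lambda>q. lat q + \<omega> q))"

definition dens :: "real \<Rightarrow> real^'n \<Rightarrow> real" where
  "dens \<theta> x = exp (- (norm x powr \<theta>)) /
      integral\<^sup>L lborel (\<lambda>y::real^'n. exp (- (norm y powr \<theta>)))"

definition Ptheta :: "real \<Rightarrow> (real^'n) set measure" where
  "Ptheta \<theta> = distr (PiM UNIV (\<lambda>_::int^'n. density lborel (\<lambda>x. ennreal (dens \<theta> x))))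
      XiM pert_cfg"

definition Pinf :: "(real^'n) set measure" where
  "Pinf = distr (PiM UNIV (\<lambda>_::int^'n. uniform_measure lborel (ball 0 1))) XiM pert_cfg"

text \<open>P_0: Poisson point process with Lebesgue intensity, constructed by placing in each
  unit cube lat q + [0,1)^d an independent Poisson(1) number of i.i.d. uniform points.\<close>
definition unit_cube :: "(real^'n) set" where
  "unit_cube = {x. \<forall>i. 0 \<le> x $ i \<and> x $ i < 1}"

definition poisson_cfg :: "(int^'n \<Rightarrow> nat) \<times> ((int^'n) \<times> nat \<Rightarrow> real^'n) \<Rightarrow> (real^'n) set" where
  "poisson_cfg = (\<lambda>(N, U). to_Xi {lat q + U (q, j) | q j. j < N q})"

definition Pzero :: "(real^'n) set measure" where
  "Pzero = distr
     (PiM UNIV (\<lambda>_::int^'n. measure_pmf (poisson_pmf 1))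
        \<Otimes>\<^sub>M PiM UNIV (\<lambda>_::(int^'n) \<times> nat. uniform_measure lborel unit_cube))
     XiM poisson_cfg"

definition weak_conv_Xi ::
  "('a \<Rightarrow> (real^'n) set measure) \<Rightarrow> (real^'n) set measure \<Rightarrow> 'a filter \<Rightarrow> bool" where
  "weak_conv_Xi P Q F \<longleftrightarrow>
     (\<forall>G. continuous_map vague euclideanreal G \<and> (\<exists>B. \<forall>S\<in>Xi. \<bar>G S\<bar> \<le> B) \<longrightarrow>
        ((\<lambda>t. integral\<^sup>L (P t) G) \<longlongrightarrow> integral\<^sup>L Q G) F)"

end

theory Submission
  imports Defs "HOL-Real_Asymp.Real_Asymp"
begin

text \<open>
  The vague topology on \<open>Xi\<close> is the initial topology of countably many functions
  \<open>exp (- pint (e j) S)\<close>, which embed \<open>Xi\<close> into the compact cube \<open>[0,1]\<^sup>\<nat>\<close>. Hence a bounded continuous function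
  on \<open>Xi\<close> is an increasing limit of Lipschitz functions of these coordinates, and by Stone-Weierstrass
  weak convergence follows from the convergence of the Laplace functionals \<open>\<integral> exp (- pint f S) dP\<close> for \<open>f \<ge> 0\<close>.

  For i.i.d. perturbations with law \<open>\<mu>\<close> the Laplace functional is \<open>\<Prod>q. 1 - hit f \<mu> q\<close> with
  \<open>hit f \<mu> q = \<integral> 1 - exp (- f (lat q + x)) d\<mu>\<close>. As \<open>\<theta> \<rightarrow> \<infinity>\<close> the densities converge in \<open>L\<^sup>1\<close>, and since boundedly
  many lattice translates meet the support of \<open>f\<close>, the products converge. As \<open>\<theta> \<rightarrow> 0\<close> every \<open>hit f \<mu> q\<close>
  is at most \<open>\<integral> (1 - exp (- f)) / Z\<close> with normalising constant \<open>Z \<rightarrow> \<infinity>\<close>, while a Riemann sum comparison gives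
  \<open>(\<Sum>q. hit f \<mu> q) \<rightarrow> \<integral> 1 - exp (- f)\<close>; so the product tends to \<open>exp (- \<integral> 1 - exp (- f))\<close>, the Laplace functional
  of the Poisson process.
\<close>

section \<open>Integration against configurations and separability of the test functions\<close>

lemma Xi_finite_cball: "S \<in> Xi \<Longrightarrow> finite (S \<inter> cball 0 r)"
  by (auto simp: Xi_def)

lemma XiI_cball:
  assumes "\<And>n::nat. finite (S \<inter> cball 0 (real n))"
  shows "S \<in> Xi"
proof -
  have "finite (S \<inter> K)" if K: "compact K" for K
  proof -
    obtain B where B: "\<And>x. x \<in> K \<Longrightarrow> norm x \<le> B"
      using compact_imp_bounded[OF K] by (auto simp: bounded_iff)
    obtain n :: nat where "B \<le> real n" using real_arch_simple by blast
    then have "S \<inter> K \<subseteq> S \<inter> cball 0 (real n)" using B by force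
    then show ?thesis using assms finite_subset by blast
  qed
  then show ?thesis by (auto simp: Xi_def)
qed

lemma Cc_support:
  assumes "f \<in> Cc"
  obtains n :: nat where "\<And>x. f x \<noteq> 0 \<Longrightarrow> norm x \<le> real n"
proof -
  obtain B where B: "\<And>x. f x \<noteq> 0 \<Longrightarrow> norm x \<le> B"
    using assms by (auto simp: Cc_def bounded_iff)
  obtain n :: nat where "B \<le> real n" using real_arch_simple by blast
  with B have "norm x \<le> real n" if "f x \<noteq> 0" for x using that by fastforce
  then show ?thesis by (rule that)
qed

lemma Cc_borel_measurable: "f \<in> Cc \<Longrightarrow> f \<in> borel_measurable borel"
  by (auto simp: Cc_def intro: borel_measurable_continuous_onI)

lemma pint_eq_sum:
  assumes S: "S \<in> Xi" and f: "\<And>x. f x \<noteq> 0 \<Longrightarrow> norm x \<le> r"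
  shows "pint f S = sum f (S \<inter> cball 0 r)"
  unfolding pint_def
  by (rule sum.mono_neutral_left) (use Xi_finite_cball[OF S] f in auto)

lemma Cc_add: "f \<in> Cc \<Longrightarrow> g \<in> Cc \<Longrightarrow> (\<lambda>x. f x + g x) \<in> Cc"
proof -
  assume fg: "f \<in> Cc" "g \<in> Cc"
  have "{x. f x + g x \<noteq> 0} \<subseteq> {x. f x \<noteq> 0} \<union> {x. g x \<noteq> 0}" by auto
  with fg show ?thesis
    unfolding Cc_def by (auto intro!: continuous_intros intro: bounded_subset[rotated])
qed

lemma pint_add:
  assumes "S \<in> Xi" "f \<in> Cc" "g \<in> Cc"
  shows "pint (\<lambda>x. f x + g x) S = pint f S + pint g S"
proof -
  obtain n :: nat where n: "\<And>x. f x \<noteq> 0 \<Longrightarrow> norm x \<le> real n" using Cc_support assms by blast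
  obtain m :: nat where m: "\<And>x. g x \<noteq> 0 \<Longrightarrow> norm x \<le> real m" using Cc_support assms by blast
  let ?r = "max (real n) (real m)"
  have "pint f S = sum f (S \<inter> cball 0 ?r)" "pint g S = sum g (S \<inter> cball 0 ?r)"
    by (rule pint_eq_sum[OF assms(1)]; use n m in force)+
  moreover have "norm x \<le> ?r" if "f x + g x \<noteq> 0" for x
    using n[of x] m[of x] that by (cases "f x = 0") auto
  then have "pint (\<lambda>x. f x + g x) S = sum (\<lambda>x. f x + g x) (S \<inter> cball 0 ?r)"
    by (rule pint_eq_sum[OF assms(1)])
  ultimately show ?thesis by (simp add: sum.distrib)
qed

lemma pint_diff_le:
  assumes S: "S \<in> Xi" and f: "f \<in> Cc" and g: "g \<in> Cc" and h: "h \<in> Cc"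
    and le: "\<And>x. \<bar>f x - g x\<bar> \<le> c * h x"
  shows "\<bar>pint f S - pint g S\<bar> \<le> c * pint h S"
proof -
  obtain n :: nat where n: "\<And>x. f x \<noteq> 0 \<Longrightarrow> norm x \<le> real n" using Cc_support f by blast
  obtain m :: nat where m: "\<And>x. g x \<noteq> 0 \<Longrightarrow> norm x \<le> real m" using Cc_support g by blast
  obtain k :: nat where k: "\<And>x. h x \<noteq> 0 \<Longrightarrow> norm x \<le> real k" using Cc_support h by blast
  let ?r = "max (real k) (max (real n) (real m))"
  have eq: "pint f S = sum f (S \<inter> cball 0 ?r)" "pint g S = sum g (S \<inter> cball 0 ?r)"
    "pint h S = sum h (S \<inter> cball 0 ?r)"
    by (rule pint_eq_sum[OF S]; use n m k in fastforce)+
  have "\<bar>sum f (S \<inter> cball 0 ?r) - sum g (S \<inter> cball 0 ?r)\<bar> \<le> (\<Sum>x\<in>S \<inter> cball 0 ?r. \<bar>f x - g x\<bar>)"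
    by (simp add: sum_abs flip: sum_subtractf)
  also have "\<dots> \<le> (\<Sum>x\<in>S \<inter> cball 0 ?r. c * h x)"
    by (intro sum_mono le)
  finally show ?thesis unfolding eq by (simp add: sum_distrib_left)
qed

lemma pint_nonneg: "(\<And>x. 0 \<le> f x) \<Longrightarrow> 0 \<le> pint f S"
  unfolding pint_def by (intro sum_nonneg) auto

fun tents :: "(real \<times> nat \<times> (real^'n)) list \<Rightarrow> real^'n \<Rightarrow> real" where
  "tents [] x = 0"
| "tents ((a, l, c) # ts) x = max (a - real (Suc l) * norm (x - c)) (tents ts x)"

lemma tents_le_iff:
  "tents ts x \<le> b \<longleftrightarrow> 0 \<le> b \<and> (\<forall>(a, l, c) \<in> set ts. a - real (Suc l) * norm (x - c) \<le> b)"
  by (induction ts x rule: tents.induct) auto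

lemma tents_nonneg: "0 \<le> tents ts x"
  by (induction ts x rule: tents.induct) auto

lemma tents_ge: "(a, l, c) \<in> set ts \<Longrightarrow> a - real (Suc l) * norm (x - c) \<le> tents ts x"
  using tents_le_iff[of ts x "tents ts x"] by auto

lemma continuous_on_tents: "continuous_on UNIV (tents ts)"
proof (induction ts)
  case Nil
  have "tents [] = (\<lambda>x. 0)" by auto
  then show ?case by simp
next
  case (Cons t ts)
  obtain a l c where t: "t = (a, l, c)" by (cases t)
  have "tents (t # ts) = (\<lambda>x. max (a - real (Suc l) * norm (x - c)) (tents ts x))"
    by (auto simp: t)
  with Cons show ?case by (auto intro!: continuous_intros)
qed

lemma tents_in_Cc: "tents ts \<in> Cc"
proof -
  have "bounded {x. tents ts x \<noteq> 0}"
  proof (induction ts)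
    case Nil
    then show ?case by simp
  next
    case (Cons t ts)
    obtain a l c where t: "t = (a, l, c)" by (cases t)
    have "norm (x - c) < a" if "0 < a - real (Suc l) * norm (x - c)" for x
    proof -
      have "1 * norm (x - c) \<le> real (Suc l) * norm (x - c)" by (intro mult_right_mono) auto
      with that show ?thesis by simp
    qed
    then have "{x. tents (t # ts) x \<noteq> 0} \<subseteq> {x. tents ts x \<noteq> 0} \<union> ball c a"
      using tents_nonneg[of ts] by (auto simp: t dist_norm norm_minus_commute max_def split: if_splits)
    moreover have "bounded ({x. tents ts x \<noteq> 0} \<union> ball c a)" using Cons by simp
    ultimately show ?case by (rule bounded_subset[rotated])
  qed
  then show ?thesis by (simp add: Cc_def continuous_on_tents)
qed

text \<open>A uniformly continuous \<open>f \<ge> 0\<close> is close to the finite supremum of the tents \<open>f c - L * norm (x - c)\<close>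
  over a fine net of points \<open>c\<close>, if the slope \<open>L\<close> is large and the mesh is small compared to \<open>1/L\<close>.\<close>

lemma tents_approx:
  fixes f :: "real^'n \<Rightarrow> real" and D :: "(real^'n) set"
  assumes f: "f \<in> Cc" and f0: "\<And>x. 0 \<le> f x" and supp: "\<And>x. f x \<noteq> 0 \<Longrightarrow> norm x \<le> n"
    and D: "\<And>X. open X \<Longrightarrow> X \<noteq> {} \<Longrightarrow> \<exists>d\<in>D. d \<in> X" and e: "0 < e"
  shows "\<exists>ts\<in>lists (\<rat> \<times> UNIV \<times> D). (\<forall>x. \<bar>f x - tents ts x\<bar> \<le> e) \<and> (\<forall>x. tents ts x \<noteq> 0 \<longrightarrow> norm x \<le> n + 2)"
proof -
  have cont: "continuous_on (cball 0 (n+2)) f"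
    using f by (auto simp: Cc_def intro: continuous_on_subset)
  have "uniformly_continuous_on (cball 0 (n+2)) f"
    using cont by (intro compact_uniformly_continuous) auto
  from this[unfolded uniformly_continuous_on_def, rule_format, of "e/2"]
  obtain d0 where d0: "d0 > 0" "\<And>x y. norm x \<le> n+2 \<Longrightarrow> norm y \<le> n+2 \<Longrightarrow> dist y x < d0 \<Longrightarrow> dist (f y) (f x) < e/2"
    using e by auto
  define d where "d = min d0 1"
  have d: "0 < d" "d \<le> 1" "d \<le> d0" using d0 by (auto simp: d_def)
  have unif: "\<bar>f y - f x\<bar> < e/2" if "norm x \<le> n+1" "norm (y - x) < d" for x y
  proof -
    have "norm y \<le> norm x + norm (y - x)" by (metis add.commute diff_add_cancel norm_triangle_ineq)
    then have "norm y \<le> n+2" using that d by linarith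
    then show ?thesis using d0(2)[of x y] that d by (auto simp: dist_norm)
  qed
  have "compact (f ` cball 0 (n+2))" using cont by (intro compact_continuous_image) auto
  then obtain M0 where M0: "\<And>x. x \<in> cball 0 (n+2) \<Longrightarrow> norm (f x) \<le> M0"
    by (meson bounded_iff compact_imp_bounded imageI)
  define M where "M = max M0 0"
  have M: "f x \<le> M" for x
  proof (cases "norm x \<le> n+2")
    case True then show ?thesis using M0[of x] by (auto simp: M_def)
  next
    case False then have "f x = 0" using supp[of x] by auto
    then show ?thesis by (auto simp: M_def)
  qed
  obtain l :: nat where "M / d \<le> real l" using real_arch_simple by blast
  then have "M \<le> real l * d" using d by (simp add: field_simps)
  also have "\<dots> \<le> real (Suc l) * d" using d by simp
  finally have l: "M \<le> real (Suc l) * d" .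
  define r where "r = min d (e / 4 / real (Suc l))"
  have r: "0 < r" "r \<le> d" "real (Suc l) * r \<le> e / 4"
  proof -
    show "0 < r" "r \<le> d" using d e by (auto simp: r_def)
    have "real (Suc l) * r \<le> real (Suc l) * (e / 4 / real (Suc l))"
      by (intro mult_left_mono) (auto simp: r_def)
    also have "\<dots> = e / 4" by (rule nonzero_mult_div_cancel_left[of "real (Suc l)" "e/4", folded times_divide_eq_right]) simp
    finally show "real (Suc l) * r \<le> e / 4" .
  qed
  let ?E = "{c\<in>D. norm c \<le> n+1}"
  have "cball 0 n \<subseteq> (\<Union>c\<in>?E. ball c r)"
  proof
    fix x :: "real^'n" assume x: "x \<in> cball 0 n"
    obtain c where c: "c \<in> D" "c \<in> ball x r" using D[of "ball x r"] r by auto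
    have "norm c \<le> norm x + norm (c - x)" by (metis add.commute diff_add_cancel norm_triangle_ineq)
    then have "norm c \<le> n+1" using x c r d by (auto simp: dist_norm norm_minus_commute)
    then show "x \<in> (\<Union>c\<in>?E. ball c r)" using c by (auto simp: dist_commute)
  qed
  then obtain E where E: "E \<subseteq> ?E" "finite E" "cball 0 n \<subseteq> (\<Union>c\<in>E. ball c r)"
    by (rule compactE_image[OF compact_cball, rotated]) auto
  have "\<exists>q\<in>\<rat>. f c - e/4 < q \<and> q < f c" for c
    using Rats_dense_in_real[of "f c - e/4" "f c"] e by auto
  then obtain q where q: "\<And>c. q c \<in> \<rat>" "\<And>c. f c - e/4 < q c" "\<And>c. q c < f c" by metis
  obtain cs where cs: "set cs = E" using E finite_list by blast
  define ts where "ts = map (\<lambda>c. (q c, l, c)) cs"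
  have ts: "set ts = (\<lambda>c. (q c, l, c)) ` E" by (simp add: ts_def cs)
  have far: "q c - real (Suc l) * norm (x - c) \<le> 0" if "norm (x - c) \<ge> d" for x c
  proof -
    have "real (Suc l) * d \<le> real (Suc l) * norm (x - c)" using that by (intro mult_left_mono) auto
    then show ?thesis using l q(3)[of c] M[of c] by linarith
  qed
  have up: "tents ts x \<le> f x + e" for x
  proof -
    have "q c - real (Suc l) * norm (x - c) \<le> f x + e" if c: "c \<in> E" for c
    proof (cases "norm (x - c) < d")
      case True
      have "\<bar>f x - f c\<bar> < e/2" using unif[of c x] True c E by auto
      moreover have "0 \<le> real (Suc l) * norm (x - c)" by simp
      ultimately show ?thesis using q(3)[of c] e by linarith
    next
      case False
      then show ?thesis using far[of x c] f0[of x] e by linarith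
    qed
    then show ?thesis using f0[of x] e by (auto simp: tents_le_iff ts)
  qed
  have low: "f x \<le> tents ts x + e" for x
  proof (cases "norm x \<le> n")
    case True
    then obtain c where c: "c \<in> E" "norm (x - c) < r" using E(3) by (auto simp: dist_norm norm_minus_commute)
    have "\<bar>f x - f c\<bar> < e/2" using unif[of c x] c E r by auto
    moreover have "q c - real (Suc l) * norm (x - c) \<le> tents ts x"
      by (rule tents_ge) (use c ts in auto)
    moreover have "real (Suc l) * norm (x - c) \<le> real (Suc l) * r" using c by (intro mult_left_mono) auto
    ultimately show ?thesis using q(2)[of c] r(3) by linarith
  next
    case False
    then have "f x = 0" using supp by auto
    then show ?thesis using tents_nonneg[of ts x] e by linarith
  qed
  have "norm x \<le> n + 2" if "tents ts x \<noteq> 0" for x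
  proof (rule ccontr)
    assume x: "\<not> norm x \<le> n + 2"
    have "q c - real (Suc l) * norm (x - c) \<le> 0" if c: "c \<in> E" for c
    proof (rule far)
      have "norm x \<le> norm c + norm (x - c)" by (metis add.commute diff_add_cancel norm_triangle_ineq)
      moreover have "norm c \<le> n+1" using c E by auto
      ultimately show "d \<le> norm (x - c)" using x d by linarith
    qed
    then have "tents ts x \<le> 0" by (auto simp: tents_le_iff ts)
    then show False using that tents_nonneg[of ts x] by linarith
  qed
  moreover have "ts \<in> lists (\<rat> \<times> UNIV \<times> D)"
    using q E by (auto simp: ts)
  moreover have "\<bar>f x - tents ts x\<bar> \<le> e" for x using up[of x] low[of x] by linarith
  ultimately show ?thesis by blast
qed

lemma Cc_separable:
  obtains e :: "nat \<Rightarrow> real^'n \<Rightarrow> real"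
  where "\<And>j. e j \<in> Cc" "\<And>j x. 0 \<le> e j x"
    "\<forall>f\<in>Cc. (\<forall>x. 0 \<le> f x) \<longrightarrow> (\<exists>i. \<forall>\<delta>>0. \<exists>j. \<forall>x. \<bar>f x - e j x\<bar> \<le> \<delta> * e i x)"
proof -
  obtain D0 :: "(real^'n) set" where D0: "countable D0" "\<And>X. open X \<Longrightarrow> X \<noteq> {} \<Longrightarrow> \<exists>d\<in>D0. d \<in> X"
    using countable_dense_exists by metis
  define D where "D = insert 0 D0"
  have D: "countable D" "\<And>X. open X \<Longrightarrow> X \<noteq> {} \<Longrightarrow> \<exists>d\<in>D. d \<in> X"
    using D0 by (auto simp: D_def)
  let ?L = "lists (\<rat> \<times> UNIV \<times> D) :: (real \<times> nat \<times> (real^'n)) list set"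
  have cnt: "countable ?L"
    using D by (intro countable_lists countable_SIGMA countable_rat) auto
  have ne: "?L \<noteq> {}" by auto
  define e where "e j = tents (from_nat_into ?L j)" for j
  have ex: "\<exists>j. e j = tents ts" if "ts \<in> ?L" for ts
    using from_nat_into_surj[OF cnt that] by (auto simp: e_def)
  show thesis
  proof (rule that)
    show "e j \<in> Cc" "0 \<le> e j x" for j x by (auto simp: e_def tents_in_Cc tents_nonneg)
    show "\<forall>f\<in>Cc. (\<forall>x. 0 \<le> f x) \<longrightarrow> (\<exists>i. \<forall>\<delta>>0. \<exists>j. \<forall>x. \<bar>f x - e j x\<bar> \<le> \<delta> * e i x)"
    proof (intro ballI impI)
      fix f :: "real^'n \<Rightarrow> real" assume "f \<in> Cc" "\<forall>x. 0 \<le> f x"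
      then have f: "f \<in> Cc" "\<And>x. 0 \<le> f x" by auto
      obtain n :: nat where n: "\<And>x. f x \<noteq> 0 \<Longrightarrow> norm x \<le> real n" using Cc_support f by blast
      have "[(real n + 3, 0, 0)] \<in> ?L" by (auto simp: D_def)
      with ex obtain i where i: "e i = tents [(real n + 3, 0, 0)]" by metis
      have big: "1 \<le> e i x" if "norm x \<le> real n + 2" for x
        using that by (auto simp: i)
      have "\<exists>j. \<forall>x. \<bar>f x - e j x\<bar> \<le> \<delta> * e i x" if "\<delta> > 0" for \<delta>
      proof -
        obtain ts where ts: "ts \<in> ?L" "\<And>x. \<bar>f x - tents ts x\<bar> \<le> \<delta>" "\<And>x. tents ts x \<noteq> 0 \<Longrightarrow> norm x \<le> real n + 2"
          using tents_approx[OF f n D(2) \<open>\<delta> > 0\<close>] by blast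
        obtain j where j: "e j = tents ts" using ex[OF ts(1)] by blast
        have "\<bar>f x - e j x\<bar> \<le> \<delta> * e i x" for x
        proof (cases "norm x \<le> real n + 2")
          case True
          then have "\<delta> * 1 \<le> \<delta> * e i x" using that big by (intro mult_left_mono) auto
          then show ?thesis using ts(2)[of x] by (simp add: j)
        next
          case False
          then have "f x = 0" "e j x = 0" using n[of x] ts(3)[of x] by (auto simp: j)
          moreover have "0 \<le> e i x" by (simp add: i)
          ultimately show ?thesis using that by simp
        qed
        then show ?thesis by blast
      qed
      then show "\<exists>i. \<forall>\<delta>>0. \<exists>j. \<forall>x. \<bar>f x - e j x\<bar> \<le> \<delta> * e i x" by blast
    qed
  qed
qed

section \<open>Weak convergence from Laplace functionals\<close>

lemma openin_vague_pint:
  assumes "f \<in> Cc" "open U"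
  shows "openin vague {S \<in> Xi. pint f S \<in> U}"
proof -
  have "openin (topology_generated_by {{S. pint f S \<in> U} | f U. f \<in> Cc \<and> open U}) {S. pint f S \<in> U}"
    using assms by (intro topology_generated_by_Basis) blast
  then show ?thesis
    unfolding vague_def openin_subtopology by blast
qed

lemma openin_vague_subset: "openin vague U \<Longrightarrow> U \<subseteq> Xi"
  unfolding vague_def openin_subtopology by blast

lemma space_XiM [simp]: "space XiM = Xi"
  using openin_vague_subset unfolding XiM_def by (intro space_measure_of) blast

lemma sets_XiM: "sets XiM = sigma_sets Xi {U. openin vague U}"
  using openin_vague_subset unfolding XiM_def by (intro sets_measure_of) blast

lemma topspace_vague [simp]: "topspace vague = Xi"
proof -
  have "(\<lambda>_. 0) \<in> Cc" by (simp add: Cc_def)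
  from openin_vague_pint[OF this, of UNIV] have "openin vague Xi" by simp
  then show ?thesis using openin_vague_subset[OF openin_topspace] openin_subset by blast
qed

lemma continuous_map_vague_measurable:
  fixes G :: "(real^'n) set \<Rightarrow> real"
  assumes "continuous_map vague euclideanreal G"
  shows "G \<in> borel_measurable XiM"
proof (rule borel_measurableI)
  fix U :: "real set" assume "open U"
  then have "openin vague {S \<in> topspace vague. G S \<in> U}"
    using assms by (intro openin_continuous_map_preimage) auto
  moreover have "{S \<in> topspace vague. G S \<in> U} = G -` U \<inter> space XiM" by auto
  ultimately show "G -` U \<inter> space XiM \<in> sets XiM" by (auto simp: sets_XiM)
qed

lemma pint_measurable:
  assumes "f \<in> Cc"
  shows "pint f \<in> borel_measurable XiM"
proof (rule borel_measurableI)
  fix U :: "real set" assume "open U"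
  then have "openin vague {S \<in> Xi. pint f S \<in> U}" using assms by (intro openin_vague_pint)
  moreover have "{S \<in> Xi. pint f S \<in> U} = pint f -` U \<inter> space XiM" by auto
  ultimately show "pint f -` U \<inter> space XiM \<in> sets XiM" by (auto simp: sets_XiM)
qed

lemma vague_embedding:
  obtains e :: "nat \<Rightarrow> real^'n \<Rightarrow> real"
  where "\<And>j. e j \<in> Cc" "\<And>j x. 0 \<le> e j x"
    "\<And>U. openin vague U \<Longrightarrow> \<exists>V. open V \<and> U = {S \<in> Xi. (\<lambda>j. exp (- pint (e j) S)) \<in> V}"
proof -
  obtain e :: "nat \<Rightarrow> real^'n \<Rightarrow> real" where
    e: "\<And>j. e j \<in> Cc" "\<And>j x. 0 \<le> e j x"
    and dense: "\<forall>f\<in>Cc. (\<forall>x. 0 \<le> f x) \<longrightarrow> (\<exists>i. \<forall>\<delta>>0. \<exists>j. \<forall>x. \<bar>f x - e j x\<bar> \<le> \<delta> * e i x)"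
    by (rule Cc_separable) (rule that, auto)
  define Y where "Y S = (\<lambda>j. exp (- pint (e j) S))" for S
  have nonneg_case: "\<exists>V. open V \<and> Y S \<in> V \<and> (\<forall>T\<in>Xi. Y T \<in> V \<longrightarrow> \<bar>pint f T - pint f S\<bar> < \<epsilon>)"
    if f: "f \<in> Cc" "\<And>x. 0 \<le> f x" and S: "S \<in> Xi" and \<epsilon>: "0 < \<epsilon>" for f S and \<epsilon> :: real
  proof -
    obtain i where i: "\<And>\<delta>. \<delta> > 0 \<Longrightarrow> \<exists>j. \<forall>x. \<bar>f x - e j x\<bar> \<le> \<delta> * e i x"
      using dense[rule_format, OF f] by auto
    define C where "C = pint (e i) S"
    have C: "0 \<le> C" unfolding C_def by (intro pint_nonneg e)
    define \<delta> where "\<delta> = \<epsilon> / 4 / (C + 1)"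
    have C1: "C + 1 > 0" using C by linarith
    have \<delta>: "\<delta> > 0" unfolding \<delta>_def by (intro divide_pos_pos \<epsilon> C1) auto
    have \<delta>C: "\<delta> * (C + 1) = \<epsilon> / 4" unfolding \<delta>_def using C1 by (metis less_irrefl nonzero_eq_divide_eq)
    obtain j where j: "\<And>x. \<bar>f x - e j x\<bar> \<le> \<delta> * e i x" using i[OF \<delta>] by blast
    define p where "p = pint (e j) S"
    define V where "V = {y::nat\<Rightarrow>real. exp (- (C + 1)) < y i} \<inter> {y. exp (- (p + \<epsilon>/4)) < y j} \<inter> {y. y j < exp (- (p - \<epsilon>/4))}"
    have "open V" unfolding V_def
      by (intro open_Int open_Collect_less continuous_intros continuous_on_product_coordinates)
    moreover have "Y S \<in> V" using \<epsilon> by (auto simp: V_def Y_def C_def p_def)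
    moreover have "\<bar>pint f T - pint f S\<bar> < \<epsilon>" if T: "T \<in> Xi" "Y T \<in> V" for T
    proof -
      have T': "pint (e i) T < C + 1" "\<bar>pint (e j) T - p\<bar> < \<epsilon>/4"
        using T(2) unfolding V_def Y_def Int_iff mem_Collect_eq exp_less_cancel_iff by linarith+
      have "\<bar>pint f T - pint (e j) T\<bar> \<le> \<delta> * pint (e i) T"
        using T f e j by (intro pint_diff_le) auto
      also have "\<dots> \<le> \<delta> * (C + 1)" using T' \<delta> by (intro mult_left_mono) auto
      finally have 1: "\<bar>pint f T - pint (e j) T\<bar> \<le> \<epsilon>/4" unfolding \<delta>C .
      have "\<bar>pint f S - p\<bar> \<le> \<delta> * C"
        unfolding C_def p_def using S f e j by (intro pint_diff_le) auto
      also have "\<dots> \<le> \<delta> * (C + 1)" using \<delta> by (intro mult_left_mono) auto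
      finally have 2: "\<bar>pint f S - p\<bar> \<le> \<epsilon>/4" unfolding \<delta>C .
      show ?thesis using 1 2 T'(2) \<epsilon> by linarith
    qed
    ultimately show ?thesis by blast
  qed
  have general_case: "\<exists>V. open V \<and> Y S \<in> V \<and> (\<forall>T\<in>Xi. Y T \<in> V \<longrightarrow> pint f T \<in> U)"
    if f: "f \<in> Cc" and U: "open U" and S: "S \<in> Xi" "pint f S \<in> U" for f S U
  proof -
    obtain \<epsilon> where \<epsilon>: "\<epsilon> > 0" "ball (pint f S) \<epsilon> \<subseteq> U" using U S open_contains_ball by blast
    let ?p = "\<lambda>x. max (f x) 0" and ?n = "\<lambda>x. max (- f x) 0"
    have "bounded {x. ?p x \<noteq> 0}" "bounded {x. ?n x \<noteq> 0}"
      by (rule bounded_subset[of "{x. f x \<noteq> 0}"]; use f in \<open>force simp: Cc_def\<close>)+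
    then have cc: "?p \<in> Cc" "?n \<in> Cc"
      using f by (auto simp: Cc_def intro!: continuous_intros)
    have split: "pint f T = pint ?p T - pint ?n T" if "T \<in> Xi" for T
    proof -
      have "pint (\<lambda>x. f x + ?n x) T = pint f T + pint ?n T" by (rule pint_add[OF that f cc(2)])
      moreover have "(\<lambda>x. f x + ?n x) = ?p" by (auto simp: max_def)
      ultimately show ?thesis by simp
    qed
    obtain V where V: "open V" "Y S \<in> V" "\<And>T. T \<in> Xi \<Longrightarrow> Y T \<in> V \<Longrightarrow> \<bar>pint ?p T - pint ?p S\<bar> < \<epsilon>/2"
      using nonneg_case[of ?p S "\<epsilon>/2"] cc S \<epsilon> by auto
    obtain W where W: "open W" "Y S \<in> W" "\<And>T. T \<in> Xi \<Longrightarrow> Y T \<in> W \<Longrightarrow> \<bar>pint ?n T - pint ?n S\<bar> < \<epsilon>/2"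
      using nonneg_case[of ?n S "\<epsilon>/2"] cc S \<epsilon> by auto
    have "pint f T \<in> U" if T: "T \<in> Xi" "Y T \<in> V \<inter> W" for T
    proof -
      have "\<bar>pint ?p T - pint ?p S\<bar> < \<epsilon>/2" "\<bar>pint ?n T - pint ?n S\<bar> < \<epsilon>/2" using V(3) W(3) T by auto
      then have "\<bar>pint f T - pint f S\<bar> < \<epsilon>" unfolding split[OF T(1)] split[OF S(1)] by linarith
      then show ?thesis using \<epsilon> by (auto simp: dist_real_def abs_minus_commute)
    qed
    with V W show ?thesis by (intro exI[of _ "V \<inter> W"]) auto
  qed
  have gen: "\<exists>V. open V \<and> A \<inter> Xi = {S \<in> Xi. Y S \<in> V}"
    if "generate_topology_on {{S. pint f S \<in> U} | f U. f \<in> Cc \<and> open U} A" for A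
    using that
  proof induction
    case Empty
    show ?case by (intro exI[of _ "{}"]) auto
  next
    case (Int a b)
    then obtain V W where "open V" "open W" "a \<inter> Xi = {S \<in> Xi. Y S \<in> V}" "b \<inter> Xi = {S \<in> Xi. Y S \<in> W}" by blast
    then show ?case by (intro exI[of _ "V \<inter> W"]) auto
  next
    case (UN K)
    then have "\<forall>k\<in>K. \<exists>V. open V \<and> k \<inter> Xi = {S \<in> Xi. Y S \<in> V}" by blast
    then obtain V where V: "\<And>k. k \<in> K \<Longrightarrow> open (V k)" "\<And>k. k \<in> K \<Longrightarrow> k \<inter> Xi = {S \<in> Xi. Y S \<in> V k}"
      unfolding bchoice_iff by blast
    have "\<Union>K \<inter> Xi = (\<Union>k\<in>K. k \<inter> Xi)" by blast
    also have "\<dots> = {S \<in> Xi. Y S \<in> (\<Union>k\<in>K. V k)}" using V(2) by auto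
    finally have "\<Union>K \<inter> Xi = {S \<in> Xi. Y S \<in> (\<Union>k\<in>K. V k)}" .
    moreover have "open (\<Union>k\<in>K. V k)" using V(1) by (rule open_UN[rule_format])
    ultimately show ?case by (intro exI conjI)
  next
    case (Basis A)
    then obtain f U where fU: "A = {S. pint f S \<in> U}" "f \<in> Cc" "open U" by blast
    let ?V = "\<Union>{V. open V \<and> (\<forall>T\<in>Xi. Y T \<in> V \<longrightarrow> pint f T \<in> U)}"
    have "A \<inter> Xi = {S \<in> Xi. Y S \<in> ?V}"
    proof (intro set_eqI iffI)
      fix S assume "S \<in> A \<inter> Xi"
      then have S: "S \<in> Xi" "pint f S \<in> U" by (auto simp: fU(1))
      then show "S \<in> {S \<in> Xi. Y S \<in> ?V}" using general_case[OF fU(2,3) S] by blast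
    next
      fix S assume "S \<in> {S \<in> Xi. Y S \<in> ?V}"
      then show "S \<in> A \<inter> Xi" unfolding fU(1) by blast
    qed
    moreover have "open ?V" by (rule open_Union) simp
    ultimately show ?case by (intro exI conjI)
  qed
  have "\<exists>V. open V \<and> U = {S \<in> Xi. (\<lambda>j. exp (- pint (e j) S)) \<in> V}" if U: "openin vague U" for U
  proof -
    from U obtain A where "generate_topology_on {{S. pint f S \<in> U} | f U. f \<in> Cc \<and> open U} A" "U = A \<inter> Xi"
      unfolding vague_def openin_subtopology openin_topology_generated_by_iff by blast
    with gen[of A] show ?thesis unfolding Y_def by simp
  qed
  with e show thesis by (rule that)
qed

lemma measurable_XiM:
  fixes X :: "'a \<Rightarrow> (real^'n) set"
  assumes X: "\<And>\<omega>. \<omega> \<in> space M \<Longrightarrow> X \<omega> \<in> Xi"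
    and meas: "\<And>f. f \<in> Cc \<Longrightarrow> (\<And>x. 0 \<le> f x) \<Longrightarrow> (\<lambda>\<omega>. pint f (X \<omega>)) \<in> borel_measurable M"
  shows "X \<in> measurable M XiM"
proof -
  obtain e :: "nat \<Rightarrow> real^'n \<Rightarrow> real" where
    e: "\<And>j. e j \<in> Cc" "\<And>j x. 0 \<le> e j x"
    and emb: "\<And>U. openin vague U \<Longrightarrow> \<exists>V. open V \<and> U = {S \<in> Xi. (\<lambda>j. exp (- pint (e j) S)) \<in> V}"
    using vague_embedding by blast
  have [measurable]: "(\<lambda>\<omega> j. exp (- pint (e j) (X \<omega>))) \<in> borel_measurable M"
    using meas[OF e] by (intro measurable_coordinatewise_then_product) auto
  show ?thesis
  proof (rule measurable_sigma_sets[OF sets_XiM])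
    show "{U. openin vague U} \<subseteq> Pow Xi" using openin_vague_subset by blast
    show "X \<in> space M \<rightarrow> Xi" using X by auto
    fix U :: "(real^'n) set set" assume "U \<in> {U. openin vague U}"
    then obtain V where V: "open V" "U = {S \<in> Xi. (\<lambda>j. exp (- pint (e j) S)) \<in> V}" using emb by blast
    have "X -` U \<inter> space M = (\<lambda>\<omega> j. exp (- pint (e j) (X \<omega>))) -` V \<inter> space M"
      using X V by auto
    also have "\<dots> \<in> sets M" using V(1) by measurable
    finally show "X -` U \<inter> space M \<in> sets M" .
  qed
qed

inductive laplace_span :: "((real^'n) set \<Rightarrow> real) \<Rightarrow> bool" where
  exp: "f \<in> Cc \<Longrightarrow> (\<And>x. 0 \<le> f x) \<Longrightarrow> (\<And>S. S \<in> Xi \<Longrightarrow> u S = exp (- pint f S)) \<Longrightarrow> laplace_span u"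
| scale: "laplace_span u \<Longrightarrow> laplace_span (\<lambda>S. c * u S)"
| add: "laplace_span u \<Longrightarrow> laplace_span v \<Longrightarrow> laplace_span (\<lambda>S. u S + v S)"

lemma laplace_span_mult:
  assumes "laplace_span u" "laplace_span v"
  shows "laplace_span (\<lambda>S. u S * v S)"
  using assms(1)
proof induction
  case (exp f u)
  note f = exp
  from assms(2) show ?case
  proof induction
    case (exp g v)
    show ?case
    proof (rule laplace_span.exp[of "\<lambda>x. f x + g x"])
      show "(\<lambda>x. f x + g x) \<in> Cc" by (rule Cc_add[OF f(1) exp(1)])
      show "0 \<le> f x + g x" for x using f(2)[of x] exp(2)[of x] by linarith
      show "u S * v S = exp (- pint (\<lambda>x. f x + g x) S)" if "S \<in> Xi" for S
        using f(3)[OF that] exp(3)[OF that] pint_add[OF that f(1) exp(1)]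
        by (simp add: mult_exp_exp)
    qed
  next
    case (scale v c)
    then show ?case using laplace_span.scale[of "\<lambda>S. u S * v S" c] by (simp add: algebra_simps)
  next
    case (add v w)
    then show ?case using laplace_span.add[of "\<lambda>S. u S * v S" "\<lambda>S. u S * w S"] by (simp add: algebra_simps)
  qed
next
  case (scale u c)
  then show ?case using laplace_span.scale[of "\<lambda>S. u S * v S" c] by (simp add: algebra_simps)
next
  case (add u w)
  then show ?case using laplace_span.add[of "\<lambda>S. u S * v S" "\<lambda>S. w S * v S"] by (simp add: algebra_simps)
qed

lemma laplace_span_measurable_bounded:
  assumes "laplace_span u"
  shows "u \<in> borel_measurable XiM \<and> (\<exists>B. \<forall>S\<in>Xi. \<bar>u S\<bar> \<le> B)"
  using assms
proof induction
  case (exp f u)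
  have "(\<lambda>S. exp (- pint f S)) \<in> borel_measurable XiM" using pint_measurable[OF exp(1)] by measurable
  then have "u \<in> borel_measurable XiM"
    by (subst measurable_cong[where g = "\<lambda>S. exp (- pint f S)"]) (use exp in auto)
  moreover have "\<forall>S\<in>Xi. \<bar>u S\<bar> \<le> 1" using exp pint_nonneg[of f] by auto
  ultimately show ?case by blast
next
  case (scale u c)
  then obtain B where "\<forall>S\<in>Xi. \<bar>u S\<bar> \<le> B" by blast
  then have "\<forall>S\<in>Xi. \<bar>c * u S\<bar> \<le> \<bar>c\<bar> * B" by (auto simp: abs_mult mult_left_mono)
  with scale show ?case by auto
next
  case (add u v)
  then obtain B C where "\<forall>S\<in>Xi. \<bar>u S\<bar> \<le> B" "\<forall>S\<in>Xi. \<bar>v S\<bar> \<le> C" by blast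
  then have "\<forall>S\<in>Xi. \<bar>u S + v S\<bar> \<le> B + C" by (auto intro: order.trans[OF abs_triangle_ineq] add_mono)
  with add show ?case by auto
qed

definition prob_Xi :: "(real^'n) set measure \<Rightarrow> bool" where
  "prob_Xi P \<longleftrightarrow> prob_space P \<and> sets P = sets XiM"

lemma prob_Xi_integrable:
  fixes u :: "(real^'n) set \<Rightarrow> real"
  assumes P: "prob_Xi P" and u: "u \<in> borel_measurable XiM" and B: "\<And>S. S \<in> Xi \<Longrightarrow> \<bar>u S\<bar> \<le> B"
  shows "integrable P u"
proof -
  interpret prob_space P using P by (simp add: prob_Xi_def)
  have sp: "space P = Xi" using P sets_eq_imp_space_eq[of P XiM] by (auto simp: prob_Xi_def)
  show ?thesis
  proof (rule integrable_const_bound[of _ B])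
    show "AE x in P. norm (u x) \<le> B" using B by (intro AE_I2) (auto simp: sp)
    show "u \<in> borel_measurable P" using u P by (simp add: prob_Xi_def cong: measurable_cong_sets)
  qed
qed

lemma prob_Xi_integral_diff_le:
  fixes u v :: "(real^'n) set \<Rightarrow> real"
  assumes P: "prob_Xi P" and u: "integrable P u" and v: "integrable P v"
    and B: "\<And>S. S \<in> Xi \<Longrightarrow> \<bar>u S - v S\<bar> \<le> B"
  shows "\<bar>integral\<^sup>L P u - integral\<^sup>L P v\<bar> \<le> B"
proof -
  interpret prob_space P using P by (simp add: prob_Xi_def)
  have sp: "space P = Xi" using P sets_eq_imp_space_eq[of P XiM] by (auto simp: prob_Xi_def)
  have "\<bar>integral\<^sup>L P u - integral\<^sup>L P v\<bar> = \<bar>\<integral>S. u S - v S \<partial>P\<bar>" using u v by simp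
  also have "\<dots> \<le> (\<integral>S. \<bar>u S - v S\<bar> \<partial>P)" by (rule integral_abs_bound)
  also have "\<dots> \<le> (\<integral>S. B \<partial>P)" using u v B by (intro integral_mono) (auto simp: sp)
  finally show ?thesis by (simp add: prob_space)
qed

lemma laplace_span_tendsto:
  fixes P :: "'a \<Rightarrow> (real^'n) set measure"
  assumes P: "eventually (\<lambda>t. prob_Xi (P t)) F" and Q: "prob_Xi Q"
    and L: "\<And>f. f \<in> Cc \<Longrightarrow> (\<And>x. 0 \<le> f x) \<Longrightarrow>
      ((\<lambda>t. \<integral>S. exp (- pint f S) \<partial>P t) \<longlongrightarrow> (\<integral>S. exp (- pint f S) \<partial>Q)) F"
    and u: "laplace_span u"
  shows "((\<lambda>t. integral\<^sup>L (P t) u) \<longlongrightarrow> integral\<^sup>L Q u) F"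
  using u
proof induction
  case (exp f u)
  have eq: "integral\<^sup>L R u = (\<integral>S. exp (- pint f S) \<partial>R)" if "prob_Xi R" for R
    using that sets_eq_imp_space_eq[of R XiM] exp by (intro Bochner_Integration.integral_cong) (auto simp: prob_Xi_def)
  have "eventually (\<lambda>t. (\<integral>S. exp (- pint f S) \<partial>P t) = integral\<^sup>L (P t) u) F"
    using P by eventually_elim (simp add: eq)
  then show ?case using L[OF exp(1,2)] eq[OF Q] by (auto intro: Lim_transform_eventually)
next
  case (scale u c)
  then show ?case by (auto intro!: tendsto_intros)
next
  case (add u v)
  have int: "integrable R u \<and> integrable R v" if "prob_Xi R" for R
    using laplace_span_measurable_bounded[OF add(1)] laplace_span_measurable_bounded[OF add(2)]
      prob_Xi_integrable[OF that] by blast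
  have "eventually (\<lambda>t. integral\<^sup>L (P t) u + integral\<^sup>L (P t) v = (\<integral>S. u S + v S \<partial>P t)) F"
    using P by eventually_elim (simp add: int)
  moreover have "((\<lambda>t. integral\<^sup>L (P t) u + integral\<^sup>L (P t) v) \<longlongrightarrow> integral\<^sup>L Q u + integral\<^sup>L Q v) F"
    using add by (intro tendsto_add)
  ultimately show ?case using int[OF Q] by (auto intro: Lim_transform_eventually)
qed

text \<open>The inf-convolutions \<open>Gm m\<close> are Lipschitz on the compact cube \<open>[0,1]\<^sup>\<nat>\<close>, hence by Stone-Weierstrass uniform limits
  of polynomials in the coordinates \<open>exp (- pint (e j) S)\<close>, whose monomials are Laplace functionals.
  They increase to \<open>G\<close> on the image of \<open>Xi\<close>.\<close>

lemma laplace_lower_bound: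
  fixes P :: "'a \<Rightarrow> (real^'n) set measure"
  assumes P: "eventually (\<lambda>t. prob_Xi (P t)) F" and Q: "prob_Xi Q"
    and L: "\<And>f. f \<in> Cc \<Longrightarrow> (\<And>x. 0 \<le> f x) \<Longrightarrow>
      ((\<lambda>t. \<integral>S. exp (- pint f S) \<partial>P t) \<longlongrightarrow> (\<integral>S. exp (- pint f S) \<partial>Q)) F"
    and G: "continuous_map vague euclideanreal G" and B: "\<And>S. S \<in> Xi \<Longrightarrow> \<bar>G S\<bar> \<le> B" and \<epsilon>: "0 < \<epsilon>"
  shows "eventually (\<lambda>t. integral\<^sup>L Q G - \<epsilon> < integral\<^sup>L (P t) G) F"
proof -
  obtain e :: "nat \<Rightarrow> real^'n \<Rightarrow> real" where
    e: "\<And>j. e j \<in> Cc" "\<And>j x. 0 \<le> e j x"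
    and emb: "\<And>U. openin vague U \<Longrightarrow> \<exists>V. open V \<and> U = {S \<in> Xi. (\<lambda>j. exp (- pint (e j) S)) \<in> V}"
    using vague_embedding by blast
  define Y where "Y S = (\<lambda>j. exp (- pint (e j) S))" for S
  have empty_Xi: "{} \<in> (Xi :: (real^'n) set set)" by (simp add: Xi_def)
  have spQ: "space Q = Xi" using Q sets_eq_imp_space_eq[of Q XiM] by (auto simp: prob_Xi_def)
  have G_meas: "G \<in> borel_measurable XiM" using G by (rule continuous_map_vague_measurable)
  have Y_meas [measurable]: "Y \<in> borel_measurable XiM" unfolding Y_def
    using pint_measurable[OF e(1)] by (intro measurable_coordinatewise_then_product) auto
  define K where "K = (PiE UNIV (\<lambda>_. {0..1}) :: (nat \<Rightarrow> real) set)"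
  have K: "compact K"
  proof -
    have "compactin (product_topology (\<lambda>_::nat. euclideanreal) UNIV) K"
      unfolding K_def compactin_PiE by auto
    then show ?thesis by (simp add: euclidean_product_topology)
  qed
  have YK: "Y S \<in> K" for S using pint_nonneg[OF e(2)] by (auto simp: K_def Y_def)
  have cont: "((\<lambda>t. \<integral>S. h (Y S) \<partial>P t) \<longlongrightarrow> (\<integral>S. h (Y S) \<partial>Q)) F \<and> (\<forall>R. prob_Xi R \<longrightarrow> integrable R (\<lambda>S. h (Y S)))"
    if h: "continuous_on UNIV h" for h :: "(nat \<Rightarrow> real) \<Rightarrow> real"
  proof -
    let ?poly = "\<lambda>p. continuous_on UNIV p \<and> laplace_span (\<lambda>S. p (Y S))"
    have const: "?poly (\<lambda>_. c)" for c
    proof -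
      have "laplace_span (\<lambda>S. 1)"
        by (rule laplace_span.exp[of "\<lambda>_. 0"]) (auto simp: Cc_def pint_def)
      from laplace_span.scale[OF this, of c] show ?thesis by simp
    qed
    have coord: "?poly (\<lambda>y. y j)" for j
      using e by (auto simp: Y_def intro!: laplace_span.exp[of "e j"] continuous_on_product_coordinates)
    have SW: "\<exists>p. ?poly p \<and> (\<forall>y\<in>K. \<bar>h y - p y\<bar> < \<delta>)" if "0 < \<delta>" for \<delta>
    proof (rule Stone_Weierstrass_HOL[of K ?poly h \<delta>])
      show "?poly (\<lambda>x. p x + q x)" if "?poly p \<and> ?poly q" for p q
        using that by (auto intro!: continuous_intros laplace_span.add)
      show "?poly (\<lambda>x. p x * q x)" if "?poly p \<and> ?poly q" for p q
        using that by (auto intro!: continuous_intros laplace_span_mult)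
      show "\<exists>p. ?poly p \<and> p x \<noteq> p y" if "x \<in> K \<and> y \<in> K \<and> x \<noteq> y" for x y
      proof -
        from that obtain j where "x j \<noteq> y j" by blast
        with coord[of j] show ?thesis by blast
      qed
    qed (use K h const that in \<open>auto intro: continuous_on_subset\<close>)
    have "compact (h ` K)" using K h by (intro compact_continuous_image) (auto intro: continuous_on_subset)
    then obtain C where "\<forall>y\<in>h ` K. norm y \<le> C"
      using compact_imp_bounded bounded_iff by metis
    then have C: "\<bar>h y\<bar> \<le> C" if "y \<in> K" for y using that by auto
    have hY: "(\<lambda>S. h (Y S)) \<in> borel_measurable XiM"
      using borel_measurable_continuous_onI[OF h] by measurable
    have int: "integrable R (\<lambda>S. h (Y S))" if "prob_Xi R" for R
      by (rule prob_Xi_integrable[OF that hY, of C]) (use C YK in auto)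
    have "((\<lambda>t. \<integral>S. h (Y S) \<partial>P t) \<longlongrightarrow> (\<integral>S. h (Y S) \<partial>Q)) F"
    proof (rule tendstoI)
      fix r :: real assume r: "0 < r"
      obtain p where p: "?poly p" "\<And>y. y \<in> K \<Longrightarrow> \<bar>h y - p y\<bar> < r/3" using SW[of "r/3"] r by auto
      have near: "\<bar>(\<integral>S. h (Y S) \<partial>R) - (\<integral>S. p (Y S) \<partial>R)\<bar> \<le> r/3" if R: "prob_Xi R" for R
      proof (rule prob_Xi_integral_diff_le[OF R int[OF R]])
        show "integrable R (\<lambda>S. p (Y S))"
          using laplace_span_measurable_bounded[of "\<lambda>S. p (Y S)"] p prob_Xi_integrable[OF R] by blast
        show "\<bar>h (Y S) - p (Y S)\<bar> \<le> r/3" for S using p(2)[OF YK[of S]] by simp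
      qed
      have "((\<lambda>t. \<integral>S. p (Y S) \<partial>P t) \<longlongrightarrow> (\<integral>S. p (Y S) \<partial>Q)) F"
        using laplace_span_tendsto[OF P Q L] p by blast
      then have "eventually (\<lambda>t. dist (\<integral>S. p (Y S) \<partial>P t) (\<integral>S. p (Y S) \<partial>Q) < r/3) F"
        using r by (intro tendstoD) auto
      with P show "eventually (\<lambda>t. dist (\<integral>S. h (Y S) \<partial>P t) (\<integral>S. h (Y S) \<partial>Q) < r) F"
      proof eventually_elim
        case (elim t)
        then show ?case using near[OF elim(1)] near[OF Q] unfolding dist_real_def by linarith
      qed
    qed
    with int show ?thesis by blast
  qed
  define Gm where "Gm m y = (INF T\<in>Xi. G T + real m * dist y (Y T))" for m :: nat and y
  have bdd: "bdd_below ((\<lambda>T. G T + real m * dist y (Y T)) ` Xi)" for m y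
  proof (rule bdd_belowI2[where m = "-B"])
    fix T :: "(real^'n) set" assume "T \<in> Xi"
    then have "-B \<le> G T" using B[of T] by linarith
    moreover have "0 \<le> real m * dist y (Y T)" by simp
    ultimately show "-B \<le> G T + real m * dist y (Y T)" by linarith
  qed
  have Gm_le: "Gm m y \<le> G T + real m * dist y (Y T)" if "T \<in> Xi" for m y T
    unfolding Gm_def using bdd that by (rule cINF_lower)
  have Gm_ge: "b \<le> Gm m y" if "\<And>T. T \<in> Xi \<Longrightarrow> b \<le> G T + real m * dist y (Y T)" for m y b
    unfolding Gm_def using empty_Xi that by (intro cINF_greatest) auto
  have lip: "Gm m y - real m * dist y z \<le> Gm m z" for m y z
  proof (rule Gm_ge)
    fix T :: "(real^'n) set" assume "T \<in> Xi"
    from Gm_le[OF this, of m y] have "Gm m y \<le> G T + real m * dist y (Y T)" .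
    also have "\<dots> \<le> G T + real m * (dist y z + dist z (Y T))"
      by (intro add_left_mono mult_left_mono dist_triangle) auto
    finally show "Gm m y - real m * dist y z \<le> G T + real m * dist z (Y T)" by (simp add: algebra_simps)
  qed
  have "continuous_on UNIV (Gm m)" for m
  proof (rule lipschitz_on_continuous_on[of "real m"], rule lipschitz_onI)
    fix y z
    show "dist (Gm m y) (Gm m z) \<le> real m * dist y z"
      using lip[of m y z] lip[of m z y] by (auto simp: dist_real_def dist_commute abs_le_iff)
  qed simp
  note Gm = cont[OF this]
  have Gm_upper: "Gm m (Y S) \<le> G S" if "S \<in> Xi" for m S using Gm_le[OF that, of m "Y S"] by simp
  have Gm_lower: "-B \<le> Gm m y" for m y
  proof (rule Gm_ge)
    fix T :: "(real^'n) set" assume "T \<in> Xi"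
    then have "-B \<le> G T" using B[of T] by linarith
    moreover have "0 \<le> real m * dist y (Y T)" by simp
    ultimately show "-B \<le> G T + real m * dist y (Y T)" by linarith
  qed
  have "(\<lambda>m. \<integral>S. Gm m (Y S) \<partial>Q) \<longlonglongrightarrow> integral\<^sup>L Q G"
  proof (rule integral_dominated_convergence[where w = "\<lambda>_. B"])
    show "G \<in> borel_measurable Q" using G_meas Q by (simp add: prob_Xi_def cong: measurable_cong_sets)
    show "(\<lambda>S. Gm m (Y S)) \<in> borel_measurable Q" for m using Gm[of m] Q by auto
    interpret prob_space Q using Q by (simp add: prob_Xi_def)
    show "integrable Q (\<lambda>_. B)" by simp
    show "AE S in Q. norm (Gm m (Y S)) \<le> B" for m
    proof (rule AE_I2)
      fix S assume "S \<in> space Q"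
      then have "S \<in> Xi" by (simp add: spQ)
      then show "norm (Gm m (Y S)) \<le> B" using Gm_lower[of m "Y S"] Gm_upper[of S m] B[of S] by auto
    qed
    show "AE S in Q. (\<lambda>m. Gm m (Y S)) \<longlonglongrightarrow> G S"
    proof (rule AE_I2)
      fix S assume "S \<in> space Q"
      then have S: "S \<in> Xi" by (simp add: spQ)
      show "(\<lambda>m. Gm m (Y S)) \<longlonglongrightarrow> G S"
      proof (rule LIMSEQ_I)
        fix r :: real assume r: "0 < r"
        have "openin vague {T \<in> topspace vague. G T \<in> {G S - r/2<..}}"
          using G by (intro openin_continuous_map_preimage) auto
        from emb[OF this] obtain V where V: "open V" "{T \<in> Xi. G S - r/2 < G T} = {T \<in> Xi. Y T \<in> V}"
          by (auto simp: Y_def)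
        have "S \<in> {T \<in> Xi. G S - r/2 < G T}" using S r by simp
        then have "Y S \<in> V" unfolding V(2) by simp
        then obtain d where d: "0 < d" "ball (Y S) d \<subseteq> V" using V(1) open_contains_ball by blast
        obtain m0 :: nat where "2 * B / d \<le> real m0" using real_arch_simple by blast
        then have m0: "2 * B \<le> real m0 * d" using d by (simp add: field_simps)
        have "norm (Gm m (Y S) - G S) < r" if m: "m0 \<le> m" for m
        proof -
          have "G S - r/2 \<le> Gm m (Y S)"
          proof (rule Gm_ge)
            fix T :: "(real^'n) set" assume T: "T \<in> Xi"
            show "G S - r/2 \<le> G T + real m * dist (Y S) (Y T)"
            proof (cases "dist (Y S) (Y T) < d")
              case True
              then have "Y T \<in> V" using d by auto
              with T have "T \<in> {T \<in> Xi. G S - r/2 < G T}" unfolding V(2) by simp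
              then have "G S - r/2 < G T" by simp
              moreover have "0 \<le> real m * dist (Y S) (Y T)" by simp
              ultimately show ?thesis by linarith
            next
              case False
              have "real m0 * d \<le> real m * dist (Y S) (Y T)" using m False d by (intro mult_mono) auto
              then show ?thesis using m0 B[OF S] B[OF T] r by linarith
            qed
          qed
          then show ?thesis using Gm_upper[OF S, of m] r by auto
        qed
        then show "\<exists>no. \<forall>m\<ge>no. norm (Gm m (Y S) - G S) < r" by blast
      qed
    qed
  qed
  then have "eventually (\<lambda>m. integral\<^sup>L Q G - \<epsilon>/2 < (\<integral>S. Gm m (Y S) \<partial>Q)) sequentially"
    by (rule order_tendstoD) (use \<epsilon> in simp)
  then obtain m where m: "integral\<^sup>L Q G - \<epsilon>/2 < (\<integral>S. Gm m (Y S) \<partial>Q)"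
    by (auto simp: eventually_sequentially)
  have "eventually (\<lambda>t. (\<integral>S. Gm m (Y S) \<partial>Q) - \<epsilon>/2 < (\<integral>S. Gm m (Y S) \<partial>P t)) F"
    by (rule order_tendstoD(1)[OF conjunct1[OF Gm[of m]]]) (use \<epsilon> in simp)
  with P show ?thesis
  proof eventually_elim
    case (elim t)
    have sp: "space (P t) = Xi" using elim sets_eq_imp_space_eq[of "P t" XiM] by (auto simp: prob_Xi_def)
    have "(\<integral>S. Gm m (Y S) \<partial>P t) \<le> integral\<^sup>L (P t) G"
      using Gm[of m] elim prob_Xi_integrable[OF elim(1) G_meas B] Gm_upper
      by (intro integral_mono) (auto simp: sp)
    with elim m show ?case by linarith
  qed
qed

theorem weak_conv_XiI_laplace:
  fixes P :: "'a \<Rightarrow> (real^'n) set measure"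
  assumes P: "eventually (\<lambda>t. prob_Xi (P t)) F" and Q: "prob_Xi Q"
    and L: "\<And>f. f \<in> Cc \<Longrightarrow> (\<And>x. 0 \<le> f x) \<Longrightarrow>
      ((\<lambda>t. \<integral>S. exp (- pint f S) \<partial>P t) \<longlongrightarrow> (\<integral>S. exp (- pint f S) \<partial>Q)) F"
  shows "weak_conv_Xi P Q F"
  unfolding weak_conv_Xi_def
proof (intro allI impI)
  fix G :: "(real^'n) set \<Rightarrow> real"
  assume "continuous_map vague euclideanreal G \<and> (\<exists>B. \<forall>S\<in>Xi. \<bar>G S\<bar> \<le> B)"
  then obtain B where G: "continuous_map vague euclideanreal G" and B: "\<And>S. S \<in> Xi \<Longrightarrow> \<bar>G S\<bar> \<le> B" by blast
  show "((\<lambda>t. integral\<^sup>L (P t) G) \<longlongrightarrow> integral\<^sup>L Q G) F"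
  proof (rule tendstoI)
    fix \<epsilon> :: real assume \<epsilon>: "0 < \<epsilon>"
    have "eventually (\<lambda>t. (\<integral>S. - G S \<partial>Q) - \<epsilon> < (\<integral>S. - G S \<partial>P t)) F"
      by (rule laplace_lower_bound[OF P Q L _ _ \<epsilon>, of _ B]) (use G B in \<open>auto intro!: continuous_map_minus\<close>)
    moreover have "eventually (\<lambda>t. integral\<^sup>L Q G - \<epsilon> < integral\<^sup>L (P t) G) F"
      by (rule laplace_lower_bound[OF P Q L G B \<epsilon>])
    ultimately show "eventually (\<lambda>t. dist (integral\<^sup>L (P t) G) (integral\<^sup>L Q G) < \<epsilon>) F"
    proof eventually_elim
      case (elim t)
      then show ?case by (auto simp: dist_real_def)
    qed
  qed
qed

section \<open>Random configurations and the lattice\<close>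

lemma config_in_Xi_iff:
  fixes x :: "nat \<Rightarrow> real^'n"
  shows "{x i | i. A i} \<in> Xi \<longleftrightarrow>
    (\<forall>n::nat. \<exists>m. \<forall>i. A i \<and> norm (x i) \<le> real n \<longrightarrow> (\<exists>j<m. A j \<and> x j = x i))"
proof
  assume L: "{x i | i. A i} \<in> Xi"
  show "\<forall>n::nat. \<exists>m. \<forall>i. A i \<and> norm (x i) \<le> real n \<longrightarrow> (\<exists>j<m. A j \<and> x j = x i)"
  proof
    fix n :: nat
    let ?F = "{x i | i. A i} \<inter> cball 0 (real n)"
    have fin: "finite ?F" using Xi_finite_cball[OF L] .
    have "\<forall>y\<in>?F. \<exists>j. A j \<and> x j = y" by auto
    then obtain J where J: "\<And>y. y \<in> ?F \<Longrightarrow> A (J y) \<and> x (J y) = y" unfolding bchoice_iff by blast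
    have "\<exists>j<Suc (Max (J ` ?F)). A j \<and> x j = x i" if "A i \<and> norm (x i) \<le> real n" for i
    proof -
      have xi: "x i \<in> ?F" using that by auto
      then have "J (x i) < Suc (Max (J ` ?F))" using fin by (auto simp: less_Suc_eq_le)
      with J[OF xi] show ?thesis by blast
    qed
    then show "\<exists>m. \<forall>i. A i \<and> norm (x i) \<le> real n \<longrightarrow> (\<exists>j<m. A j \<and> x j = x i)" by blast
  qed
next
  assume R: "\<forall>n::nat. \<exists>m. \<forall>i. A i \<and> norm (x i) \<le> real n \<longrightarrow> (\<exists>j<m. A j \<and> x j = x i)"
  show "{x i | i. A i} \<in> Xi"
  proof (rule XiI_cball)
    fix n :: nat
    obtain m where m: "\<And>i. A i \<and> norm (x i) \<le> real n \<Longrightarrow> \<exists>j<m. A j \<and> x j = x i" using R by blast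
    have "{x i | i. A i} \<inter> cball 0 (real n) \<subseteq> x ` {..<m}"
    proof
      fix y assume "y \<in> {x i | i. A i} \<inter> cball 0 (real n)"
      then obtain i where i: "y = x i" "A i" "norm (x i) \<le> real n" by auto
      with m[of i] obtain j where "j < m" "x j = y" by auto
      then show "y \<in> x ` {..<m}" by auto
    qed
    then show "finite ({x i | i. A i} \<inter> cball 0 (real n))" by (rule finite_subset) simp
  qed
qed

text \<open>Distinct indices may give the same point, which \<open>pint\<close> counts only once: the series below
  runs over first occurrences.\<close>

lemma pint_config:
  fixes x :: "nat \<Rightarrow> real^'n"
  assumes Xi: "{x i | i. A i} \<in> Xi" and f: "f \<in> Cc"
  shows "(\<lambda>i. if A i \<and> (\<forall>j<i. \<not> (A j \<and> x j = x i)) then f (x i) else 0) sums pint f {x i | i. A i}"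
proof -
  define B where "B i \<longleftrightarrow> A i \<and> (\<forall>j<i. \<not> (A j \<and> x j = x i))" for i
  define J where "J = {i. B i \<and> f (x i) \<noteq> 0}"
  have inj: "inj_on x J"
  proof (rule inj_onI)
    fix i j assume "i \<in> J" "j \<in> J" "x i = x j"
    then have "\<not> i < j" "\<not> j < i" by (auto simp: J_def B_def)
    then show "i = j" by simp
  qed
  have first: "\<exists>j. B j \<and> x j = x i" if "A i" for i
  proof -
    define j where "j = (LEAST j. A j \<and> x j = x i)"
    have "A j \<and> x j = x i" unfolding j_def by (rule LeastI[of _ i]) (use that in simp)
    moreover have "\<not> (A k \<and> x k = x i)" if "k < j" for k using not_less_Least[of k "\<lambda>j. A j \<and> x j = x i"] that by (simp add: j_def)
    ultimately have "B j \<and> x j = x i" by (auto simp: B_def)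
    then show ?thesis by blast
  qed
  have img: "{y \<in> {x i | i. A i}. f y \<noteq> 0} = x ` J"
  proof
    show "{y \<in> {x i | i. A i}. f y \<noteq> 0} \<subseteq> x ` J"
    proof
      fix y assume "y \<in> {y \<in> {x i | i. A i}. f y \<noteq> 0}"
      then obtain i where i: "y = x i" "A i" "f y \<noteq> 0" by auto
      with first obtain j where "B j" "x j = x i" by blast
      with i show "y \<in> x ` J" by (auto simp: J_def intro!: image_eqI[of _ _ j])
    qed
    show "x ` J \<subseteq> {y \<in> {x i | i. A i}. f y \<noteq> 0}" by (auto simp: J_def B_def)
  qed
  obtain n :: nat where n: "\<And>y. f y \<noteq> 0 \<Longrightarrow> norm y \<le> real n" using Cc_support f by blast
  have "{y \<in> {x i | i. A i}. f y \<noteq> 0} \<subseteq> {x i | i. A i} \<inter> cball 0 (real n)" using n by auto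
  then have "finite (x ` J)" unfolding img[symmetric] using Xi_finite_cball[OF Xi] finite_subset by blast
  then have fin: "finite J" using inj finite_imageD by blast
  have "(\<lambda>i. if B i then f (x i) else 0) sums (\<Sum>i\<in>J. if B i then f (x i) else 0)"
    by (rule sums_finite[OF fin]) (auto simp: J_def)
  also have "(\<Sum>i\<in>J. if B i then f (x i) else 0) = (\<Sum>i\<in>J. f (x i))" by (intro sum.cong) (auto simp: J_def)
  also have "\<dots> = sum f (x ` J)" using inj by (simp add: sum.reindex)
  also have "\<dots> = pint f {x i | i. A i}" unfolding pint_def img ..
  finally show ?thesis unfolding B_def .
qed

lemma measurable_config:
  fixes x :: "nat \<Rightarrow> 'a \<Rightarrow> real^'n"
  assumes x [measurable]: "\<And>i. x i \<in> borel_measurable M"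
    and A [measurable]: "\<And>i. Measurable.pred M (A i)"
  shows "(\<lambda>\<omega>. to_Xi {x i \<omega> | i. A i \<omega>}) \<in> measurable M XiM"
proof (rule measurable_XiM)
  have empty: "{} \<in> (Xi :: (real^'n) set set)" by (simp add: Xi_def)
  then show "to_Xi {x i \<omega> | i. A i \<omega>} \<in> Xi" for \<omega> by (simp add: to_Xi_def)
  fix f :: "real^'n \<Rightarrow> real" assume f: "f \<in> Cc"
  then have [measurable]: "f \<in> borel_measurable borel" by (rule Cc_borel_measurable)
  have eq: "pint f (to_Xi {x i \<omega> | i. A i \<omega>}) =
    (if \<forall>n::nat. \<exists>m. \<forall>i. A i \<omega> \<and> norm (x i \<omega>) \<le> real n \<longrightarrow> (\<exists>j\<in>{..<m}. A j \<omega> \<and> norm (x j \<omega> - x i \<omega>) = 0)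
     then (\<Sum>i. if A i \<omega> \<and> (\<forall>j\<in>{..<i}. \<not> (A j \<omega> \<and> norm (x j \<omega> - x i \<omega>) = 0)) then f (x i \<omega>) else 0) else 0)" for \<omega>
  proof -
    have ex: "(\<exists>j\<in>{..<m}. A j \<omega> \<and> norm (x j \<omega> - x i \<omega>) = 0) \<longleftrightarrow> (\<exists>j<m. A j \<omega> \<and> x j \<omega> = x i \<omega>)"
      and all: "(\<forall>j\<in>{..<m}. \<not> (A j \<omega> \<and> norm (x j \<omega> - x i \<omega>) = 0)) \<longleftrightarrow> (\<forall>j<m. \<not> (A j \<omega> \<and> x j \<omega> = x i \<omega>))" for m i
      by auto
    show ?thesis
      unfolding ex all config_in_Xi_iff[of "\<lambda>i. x i \<omega>" "\<lambda>i. A i \<omega>", symmetric]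
      using pint_config[of "\<lambda>i. x i \<omega>" "\<lambda>i. A i \<omega>", OF _ f, THEN sums_unique]
      by (cases "{x i \<omega> | i. A i \<omega>} \<in> Xi") (simp_all add: to_Xi_def pint_def[of f "{}"])
  qed
  show "(\<lambda>\<omega>. pint f (to_Xi {x i \<omega> | i. A i \<omega>})) \<in> borel_measurable M"
    unfolding eq by measurable
qed

lemma infinite_UNIV_int_vec: "infinite (UNIV :: (int^'n) set)"
proof
  assume fin: "finite (UNIV :: (int^'n) set)"
  have "inj (\<lambda>k::int. (\<chi> i. k) :: int^'n)" by (auto simp: inj_def vec_eq_iff)
  then have "finite (UNIV :: int set)" using fin finite_imageD[of "\<lambda>k::int. (\<chi> i. k) :: int^'n" UNIV] finite_subset[OF subset_UNIV fin] by blast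
  then show False by simp
qed

definition enum_lat :: "nat \<Rightarrow> int^'n" where
  "enum_lat = from_nat_into UNIV"

lemma bij_enum_lat: "bij (enum_lat :: nat \<Rightarrow> int^'n)"
  unfolding enum_lat_def by (intro bij_betw_from_nat_into infinite_UNIV_int_vec) auto

lemma inj_enum_lat: "inj enum_lat"
  using bij_enum_lat by (rule bij_is_inj)

definition lat_bound :: "'n::finite itself \<Rightarrow> nat \<Rightarrow> real" where
  "lat_bound _ n = real ((2 * n + 1) ^ CARD('n))"

lemma card_lat_cball:
  fixes x :: "real^'n"
  shows "finite {q::int^'n. norm (lat q + x) \<le> real n}"
    and "real (card {q::int^'n. norm (lat q + x) \<le> real n}) \<le> lat_bound TYPE('n) n"
proof -
  let ?Q = "{q::int^'n. norm (lat q + x) \<le> real n}"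
  let ?I = "\<lambda>i. {\<lceil>- real n - x $ i\<rceil>..\<lfloor>real n - x $ i\<rfloor>}"
  have sub: "vec_nth ` ?Q \<subseteq> PiE UNIV ?I"
  proof
    fix g assume "g \<in> vec_nth ` ?Q"
    then obtain q :: "int^'n" where q: "g = vec_nth q" "norm (lat q + x) \<le> real n" by auto
    have "g i \<in> ?I i" for i
    proof -
      have "\<bar>(lat q + x) $ i\<bar> \<le> real n" using component_le_norm_cart[of "lat q + x" i] q by linarith
      then have "\<bar>real_of_int (q $ i) + x $ i\<bar> \<le> real n" by (simp add: lat_def)
      then show ?thesis unfolding q(1) by (auto simp: ceiling_le_iff le_floor_iff)
    qed
    then show "g \<in> PiE UNIV ?I" by auto
  qed
  have finI: "finite (PiE UNIV ?I)" by (intro finite_PiE) auto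
  have inj: "inj_on vec_nth ?Q" by (auto simp: inj_on_def vec_nth_inject)
  show "finite ?Q" using finite_imageD[OF finite_subset[OF sub finI] inj] .
  have "card ?Q \<le> card (PiE UNIV ?I)" using inj sub finI by (rule card_inj_on_le)
  also have "\<dots> = (\<Prod>i\<in>UNIV. card (?I i))" by (intro card_PiE) auto
  also have "\<dots> \<le> (\<Prod>i\<in>(UNIV::'n set). 2 * n + 1)"
  proof (intro prod_mono conjI)
    fix i :: 'n
    have "\<lfloor>real n - x $ i\<rfloor> - \<lceil>- real n - x $ i\<rceil> \<le> 2 * int n" by linarith
    then show "card (?I i) \<le> 2 * n + 1" by simp
  qed simp
  finally have "card ?Q \<le> (2 * n + 1) ^ CARD('n)" by simp
  then show "real (card ?Q) \<le> lat_bound TYPE('n) n" unfolding lat_bound_def by (rule of_nat_mono)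
qed

lemma lat_sum_le:
  fixes u :: "real^'n \<Rightarrow> real"
  assumes supp: "\<And>x. u x \<noteq> 0 \<Longrightarrow> norm x \<le> real n" and le1: "\<And>x. u x \<le> 1"
  shows "(\<Sum>i<m. u (lat (enum_lat i) + x)) \<le> lat_bound TYPE('n) n"
proof -
  let ?Q = "{q::int^'n. norm (lat q + x) \<le> real n}"
  have "(\<Sum>i<m. u (lat (enum_lat i) + x)) = (\<Sum>q\<in>enum_lat ` {..<m}. u (lat q + x))"
    by (subst sum.reindex) (auto intro: inj_on_subset[OF inj_enum_lat])
  also have "\<dots> = (\<Sum>q\<in>enum_lat ` {..<m} \<inter> ?Q. u (lat q + x))"
    using supp by (intro sum.mono_neutral_right) auto
  also have "\<dots> \<le> (\<Sum>q\<in>enum_lat ` {..<m} \<inter> ?Q. 1)" by (intro sum_mono le1)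
  also have "\<dots> = real (card (enum_lat ` {..<m} \<inter> ?Q))" by simp
  also have "\<dots> \<le> real (card ?Q)" by (intro of_nat_mono card_mono card_lat_cball) auto
  also have "\<dots> \<le> lat_bound TYPE('n) n" by (rule card_lat_cball)
  finally show ?thesis .
qed

lemma integral_PiM_prod:
  fixes g :: "'i \<Rightarrow> 'a \<Rightarrow> real"
  assumes M: "\<And>i. prob_space (M i)" and J: "finite J" and g: "\<And>i. i \<in> J \<Longrightarrow> integrable (M i) (g i)"
  shows "(\<integral>\<omega>. (\<Prod>i\<in>J. g i (\<omega> i)) \<partial>PiM UNIV M) = (\<Prod>i\<in>J. integral\<^sup>L (M i) (g i))"
proof -
  interpret product_prob_space M UNIV using M by (rule product_prob_spaceI)
  have [measurable]: "g i \<in> borel_measurable (M i)" if "i \<in> J" for i using g[OF that] by auto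
  have "(\<Prod>i\<in>J. integral\<^sup>L (M i) (g i)) = (\<integral>\<omega>. (\<Prod>i\<in>J. g i (\<omega> i)) \<partial>PiM J M)"
    using product_integral_prod[OF J g] by simp
  also have "\<dots> = (\<integral>\<omega>. (\<Prod>i\<in>J. g i (\<omega> i)) \<partial>distr (PiM UNIV M) (PiM J M) (\<lambda>x. restrict x J))"
    using distr_PiM_restrict_finite[OF J] by simp
  also have "\<dots> = (\<integral>\<omega>. (\<Prod>i\<in>J. g i (restrict \<omega> J i)) \<partial>PiM UNIV M)"
  proof (rule integral_distr)
    show "(\<lambda>x. restrict x J) \<in> PiM UNIV M \<rightarrow>\<^sub>M PiM J M" by (rule measurable_restrict_subset) auto
    show "(\<lambda>\<omega>. \<Prod>i\<in>J. g i (\<omega> i)) \<in> borel_measurable (PiM J M)"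
      by (rule borel_measurable_prod) measurable
  qed
  also have "\<dots> = (\<integral>\<omega>. (\<Prod>i\<in>J. g i (\<omega> i)) \<partial>PiM UNIV M)" by (intro Bochner_Integration.integral_cong prod.cong) auto
  finally show ?thesis ..
qed

lemma AE_PiM_neq:
  fixes M :: "'i \<Rightarrow> 'b::{second_countable_topology, t2_space} measure"
  assumes M: "\<And>i. prob_space (M i)" and ij: "i \<noteq> j"
    and sets [measurable_cong]: "\<And>i. sets (M i) = sets borel" and h [measurable]: "h \<in> borel_measurable borel"
    and null: "\<And>x. emeasure (M j) {x} = 0"
  shows "AE \<omega> in PiM UNIV M. \<omega> j \<noteq> h (\<omega> i)"
proof -
  interpret product_prob_space M UNIV using M by (rule product_prob_spaceI)
  let ?J = "{j, i}"
  let ?N = "{\<omega> \<in> space (PiM ?J M). \<omega> j = h (\<omega> i)}"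
  have N [measurable]: "?N \<in> sets (PiM ?J M)" by measurable
  have "emeasure (PiM ?J M) ?N = (\<integral>\<^sup>+\<omega>. indicator ?N \<omega> \<partial>PiM ?J M)" by simp
  also have "\<dots> = (\<integral>\<^sup>+\<omega>. (\<integral>\<^sup>+y. indicator ?N (fun_upd \<omega> j y) \<partial>M j) \<partial>PiM {i} M)"
    using ij by (intro product_nn_integral_insert) auto
  also have "\<dots> \<le> (\<integral>\<^sup>+\<omega>. (\<integral>\<^sup>+y. indicator {h (\<omega> i)} y \<partial>M j) \<partial>PiM {i} M)"
    using ij by (intro nn_integral_mono) (auto simp: indicator_def)
  also have "\<dots> = 0" using null by simp
  finally have null_N: "?N \<in> null_sets (PiM ?J M)" using N by auto
  have "AE \<omega> in PiM ?J M. \<omega> j \<noteq> h (\<omega> i)" by (rule AE_I'[OF null_N]) auto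
  then have "AE \<omega> in distr (PiM UNIV M) (PiM ?J M) (\<lambda>x. restrict x ?J). \<omega> j \<noteq> h (\<omega> i)"
    by (subst distr_PiM_restrict_finite) auto
  then have "AE \<omega> in PiM UNIV M. restrict \<omega> ?J j \<noteq> h (restrict \<omega> ?J i)"
    by (subst (asm) AE_distr_iff) (auto intro!: measurable_restrict_subset)
  then show ?thesis by simp
qed

section \<open>Perturbed lattices\<close>

definition pert_law :: "(real^'n) measure \<Rightarrow> (real^'n) set measure" where
  "pert_law \<mu> = distr (PiM UNIV (\<lambda>_::int^'n. \<mu>)) XiM pert_cfg"

definition hit :: "(real^'n \<Rightarrow> real) \<Rightarrow> (real^'n) measure \<Rightarrow> int^'n \<Rightarrow> real" where
  "hit f \<mu> q = (\<integral>x. 1 - exp (- f (lat q + x)) \<partial>\<mu>)"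

lemma pert_cfg_enum: "pert_cfg \<omega> = to_Xi {lat (enum_lat i) + \<omega> (enum_lat i) | i. True}"
proof -
  have "range (\<lambda>q. lat q + \<omega> q) = range ((\<lambda>q. lat q + \<omega> q) \<circ> enum_lat)"
    using bij_is_surj[OF bij_enum_lat] by (metis image_comp)
  then show ?thesis by (simp add: pert_cfg_def full_SetCompr_eq)
qed

lemma pert_cfg_measurable:
  fixes \<mu> :: "(real^'n) measure"
  assumes sets [measurable_cong]: "sets \<mu> = sets borel"
  shows "pert_cfg \<in> PiM UNIV (\<lambda>_::int^'n. \<mu>) \<rightarrow>\<^sub>M XiM"
  unfolding pert_cfg_enum[abs_def] by (rule measurable_config) measurable

lemma prob_Xi_pert_law:
  assumes "prob_space \<mu>" "sets \<mu> = sets borel"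
  shows "prob_Xi (pert_law \<mu>)"
  unfolding prob_Xi_def pert_law_def
  using assms by (auto intro!: prob_space.prob_space_distr prob_space_PiM pert_cfg_measurable)

lemma AE_pert_locally_finite:
  fixes \<mu> :: "(real^'n) measure"
  assumes \<mu>: "prob_space \<mu>" and sets [measurable_cong]: "sets \<mu> = sets borel"
  shows "AE \<omega> in PiM UNIV (\<lambda>_::int^'n. \<mu>). {lat (enum_lat i) + \<omega> (enum_lat i) | i. True} \<in> Xi"
proof -
  interpret \<mu>: prob_space \<mu> by fact
  interpret P: product_prob_space "\<lambda>_::int^'n. \<mu>" UNIV using \<mu> by (rule product_prob_spaceI)
  let ?M = "PiM UNIV (\<lambda>_::int^'n. \<mu>)"
  have "AE \<omega> in ?M. \<forall>\<^sub>F i in sequentially. \<not> norm (lat (enum_lat i) + \<omega> (enum_lat i)) \<le> real n" for n :: nat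
  proof -
    let ?A = "\<lambda>i. {\<omega>\<in>space ?M. norm (lat (enum_lat i) + \<omega> (enum_lat i)) \<le> real n}"
    let ?B = "\<lambda>i. {x. norm (lat (enum_lat i) + x) \<le> real n}"
    have B [measurable]: "?B i \<in> sets \<mu>" for i by measurable
    have "measure ?M (?A i) = measure \<mu> (?B i)" for i
      using P.emeasure_PiM_Collect_single[of "enum_lat i" "?B i"] by (simp add: measure_def)
    moreover have "summable (\<lambda>i. measure \<mu> (?B i))"
    proof (rule summableI_nonneg_bounded)
      fix m
      have "(\<Sum>i<m. measure \<mu> (?B i)) = (\<integral>x. (\<Sum>i<m. indicator (cball 0 (real n)) (lat (enum_lat i) + x)) \<partial>\<mu>)"
      proof (subst Bochner_Integration.integral_sum)
        show "integrable \<mu> (\<lambda>x. indicator (cball 0 (real n)) (lat (enum_lat i) + x) :: real)" for i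
          by (rule \<mu>.integrable_const_bound[of _ 1]) (auto simp: indicator_def)
        have "measure \<mu> (?B i) = (\<integral>x. indicator (?B i) x \<partial>\<mu>)" for i by simp
        also have "\<dots> i = (\<integral>x. indicator (cball 0 (real n)) (lat (enum_lat i) + x) \<partial>\<mu>)" for i
          by (intro Bochner_Integration.integral_cong) (auto simp: indicator_def)
        finally show "(\<Sum>i<m. measure \<mu> (?B i)) = (\<Sum>i<m. \<integral>x. indicator (cball 0 (real n)) (lat (enum_lat i) + x) \<partial>\<mu>)"
          by simp
      qed
      also have "\<dots> \<le> (\<integral>x. lat_bound TYPE('n) n \<partial>\<mu>)"
      proof (rule integral_mono)
        show "integrable \<mu> (\<lambda>x. (\<Sum>i<m. indicator (cball 0 (real n)) (lat (enum_lat i) + x)) :: real)"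
          by (intro Bochner_Integration.integrable_sum \<mu>.integrable_const_bound[of _ 1]) (auto simp: indicator_def)
        show "(\<Sum>i<m. indicator (cball 0 (real n)) (lat (enum_lat i) + x)) \<le> lat_bound TYPE('n) n" for x :: "real^'n"
          by (rule lat_sum_le) (auto simp: indicator_def split: if_splits)
      qed simp
      finally show "(\<Sum>i<m. measure \<mu> (?B i)) \<le> lat_bound TYPE('n) n" by (simp add: \<mu>.prob_space)
    qed simp
    ultimately have "AE \<omega> in ?M. \<forall>\<^sub>F i in sequentially. \<omega> \<in> space ?M - ?A i"
      by (intro borel_cantelli_AE1) (auto simp: P.emeasure_eq_measure)
    then show ?thesis by eventually_elim (auto elim: eventually_mono)
  qed
  then have "AE \<omega> in ?M. \<forall>n::nat. \<forall>\<^sub>F i in sequentially. \<not> norm (lat (enum_lat i) + \<omega> (enum_lat i)) \<le> real n"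
    by (simp add: AE_all_countable)
  then show ?thesis
  proof eventually_elim
    case (elim \<omega>)
    show ?case
    proof (rule XiI_cball)
      fix n :: nat
      obtain N where N: "\<And>i. i \<ge> N \<Longrightarrow> \<not> norm (lat (enum_lat i) + \<omega> (enum_lat i)) \<le> real n"
        using elim[rule_format, of n] by (auto simp: eventually_sequentially)
      have "{lat (enum_lat i) + \<omega> (enum_lat i) | i. True} \<inter> cball 0 (real n) \<subseteq> (\<lambda>i. lat (enum_lat i) + \<omega> (enum_lat i)) ` {..<N}"
      proof
        fix y assume "y \<in> {lat (enum_lat i) + \<omega> (enum_lat i) | i. True} \<inter> cball 0 (real n)"
        then obtain i where "y = lat (enum_lat i) + \<omega> (enum_lat i)" "norm y \<le> real n" by auto
        moreover from this N[of i] have "i < N" by (metis not_le)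
        ultimately show "y \<in> (\<lambda>i. lat (enum_lat i) + \<omega> (enum_lat i)) ` {..<N}" by auto
      qed
      then show "finite ({lat (enum_lat i) + \<omega> (enum_lat i) | i. True} \<inter> cball 0 (real n))"
        by (rule finite_subset) simp
    qed
  qed
qed

lemma AE_pert_inj:
  fixes \<mu> :: "(real^'n) measure"
  assumes \<mu>: "prob_space \<mu>" and sets: "sets \<mu> = sets borel" and null: "\<And>x. emeasure \<mu> {x} = 0"
  shows "AE \<omega> in PiM UNIV (\<lambda>_::int^'n. \<mu>). inj (\<lambda>i. lat (enum_lat i) + \<omega> (enum_lat i))"
proof -
  let ?M = "PiM UNIV (\<lambda>_::int^'n. \<mu>)"
  have "AE \<omega> in ?M. i \<noteq> j \<longrightarrow> lat (enum_lat i) + \<omega> (enum_lat i) \<noteq> lat (enum_lat j) + \<omega> (enum_lat j)" for i j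
  proof (cases "i = j")
    case False
    then have "enum_lat i \<noteq> (enum_lat j :: int^'n)" using inj_enum_lat by (auto dest: injD)
    then have "AE \<omega> in ?M. \<omega> (enum_lat j) \<noteq> lat (enum_lat i) + \<omega> (enum_lat i) - lat (enum_lat j)"
      by (rule AE_PiM_neq[where h = "\<lambda>y. lat (enum_lat i) + y - lat (enum_lat j)" and M = "\<lambda>_. \<mu>", rotated])
        (use \<mu> sets null in auto)
    then show ?thesis by eventually_elim (auto simp: algebra_simps)
  qed simp
  then have "AE \<omega> in ?M. \<forall>i j. i \<noteq> j \<longrightarrow> lat (enum_lat i) + \<omega> (enum_lat i) \<noteq> lat (enum_lat j) + \<omega> (enum_lat j)"
    by (simp add: AE_all_countable)
  then show ?thesis by eventually_elim (auto simp: inj_def)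
qed

lemma pint_config_inj:
  fixes x :: "nat \<Rightarrow> real^'n"
  assumes "{x i | i. True} \<in> Xi" "f \<in> Cc" "inj x"
  shows "(\<lambda>i. f (x i)) sums pint f {x i | i. True}"
proof -
  have "(\<lambda>i. if True \<and> (\<forall>j<i. \<not> (True \<and> x j = x i)) then f (x i) else 0) = (\<lambda>i. f (x i))"
    using assms(3) by (auto simp: inj_def fun_eq_iff)
  with pint_config[OF assms(1,2)] show ?thesis by simp
qed

lemma pert_laplace:
  fixes \<mu> :: "(real^'n) measure"
  assumes \<mu>: "prob_space \<mu>" and sets [measurable_cong]: "sets \<mu> = sets borel" and null: "\<And>x. emeasure \<mu> {x} = 0"
    and f: "f \<in> Cc" and f0: "\<And>x. 0 \<le> f x"
  shows "(\<lambda>m. \<Prod>i<m. 1 - hit f \<mu> (enum_lat i)) \<longlonglongrightarrow> (\<integral>S. exp (- pint f S) \<partial>pert_law \<mu>)"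
proof -
  interpret \<mu>: prob_space \<mu> by fact
  let ?M = "PiM UNIV (\<lambda>_::int^'n. \<mu>)"
  interpret M: prob_space ?M by (rule prob_space_PiM) (rule \<mu>)
  have [measurable]: "f \<in> borel_measurable borel" using f by (rule Cc_borel_measurable)
  have [measurable]: "pert_cfg \<in> ?M \<rightarrow>\<^sub>M XiM" by (rule pert_cfg_measurable) fact
  note pint_measurable[OF f, measurable]
  have int: "integrable \<mu> (\<lambda>x. exp (- f (lat q + x)))" for q
    by (rule \<mu>.integrable_const_bound[of _ 1]) (auto simp: f0)
  have "(\<Prod>i<m. 1 - hit f \<mu> (enum_lat i)) = (\<integral>\<omega>. (\<Prod>i<m. exp (- f (lat (enum_lat i) + \<omega> (enum_lat i)))) \<partial>?M)" for m
  proof -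
    have "(\<integral>\<omega>. (\<Prod>i<m. exp (- f (lat (enum_lat i) + \<omega> (enum_lat i)))) \<partial>?M)
      = (\<integral>\<omega>. (\<Prod>q\<in>enum_lat ` {..<m}. exp (- f (lat q + \<omega> q))) \<partial>?M)"
      by (subst prod.reindex) (auto intro: inj_on_subset[OF inj_enum_lat])
    also have "\<dots> = (\<Prod>q\<in>enum_lat ` {..<m}. \<integral>x. exp (- f (lat q + x)) \<partial>\<mu>)"
      by (rule integral_PiM_prod) (use \<mu> int in auto)
    also have "\<dots> = (\<Prod>i<m. \<integral>x. exp (- f (lat (enum_lat i) + x)) \<partial>\<mu>)"
      by (subst prod.reindex) (auto intro: inj_on_subset[OF inj_enum_lat])
    also have "\<dots> = (\<Prod>i<m. 1 - hit f \<mu> (enum_lat i))"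
      unfolding hit_def using int by (simp add: \<mu>.prob_space)
    finally show ?thesis ..
  qed
  moreover have "(\<lambda>m. \<integral>\<omega>. (\<Prod>i<m. exp (- f (lat (enum_lat i) + \<omega> (enum_lat i)))) \<partial>?M)
    \<longlonglongrightarrow> (\<integral>\<omega>. exp (- pint f (pert_cfg \<omega>)) \<partial>?M)"
  proof (rule integral_dominated_convergence[where w = "\<lambda>_. 1"])
    show "AE \<omega> in ?M. (\<lambda>m. \<Prod>i<m. exp (- f (lat (enum_lat i) + \<omega> (enum_lat i)))) \<longlonglongrightarrow> exp (- pint f (pert_cfg \<omega>))"
      using AE_pert_locally_finite[OF \<mu> sets] AE_pert_inj[OF \<mu> sets null]
    proof eventually_elim
      case (elim \<omega>)
      have "(\<lambda>i. f (lat (enum_lat i) + \<omega> (enum_lat i))) sums pint f (pert_cfg \<omega>)"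
        unfolding pert_cfg_enum using pint_config_inj[OF elim(1) f elim(2)] elim(1) by (simp add: to_Xi_def)
      then have "(\<lambda>m. exp (- (\<Sum>i<m. f (lat (enum_lat i) + \<omega> (enum_lat i))))) \<longlonglongrightarrow> exp (- pint f (pert_cfg \<omega>))"
        unfolding sums_def by (intro tendsto_intros)
      then show ?case by (simp add: exp_sum sum_negf[symmetric])
    qed
    show "AE \<omega> in ?M. norm (\<Prod>i<m. exp (- f (lat (enum_lat i) + \<omega> (enum_lat i)))) \<le> 1" for m
      using f0 by (intro AE_I2) (auto simp: abs_prod intro!: prod_le_1)
    show "(\<lambda>\<omega>. \<Prod>i<m. exp (- f (lat (enum_lat i) + \<omega> (enum_lat i)))) \<in> borel_measurable ?M" for m
      by measurable
  qed auto
  moreover have "(\<integral>S. exp (- pint f S) \<partial>pert_law \<mu>) = (\<integral>\<omega>. exp (- pint f (pert_cfg \<omega>)) \<partial>?M)"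
    unfolding pert_law_def by (rule integral_distr) measurable
  ultimately show ?thesis by simp
qed

lemma hit_nonneg:
  assumes "\<And>x. 0 \<le> f x"
  shows "0 \<le> hit f \<mu> q"
  unfolding hit_def by (rule Bochner_Integration.integral_nonneg) (simp add: assms)

section \<open>Perturbations with a density\<close>

definition prob_density :: "(real^'n \<Rightarrow> real) \<Rightarrow> bool" where
  "prob_density p \<longleftrightarrow> (\<forall>x. 0 \<le> p x) \<and> integrable lborel p \<and> integral\<^sup>L lborel p = 1"

lemma prob_density_measurable [measurable_dest]: "prob_density p \<Longrightarrow> p \<in> borel_measurable borel"
  by (auto simp: prob_density_def dest!: borel_measurable_integrable)

lemma prob_space_prob_density:
  assumes "prob_density p"
  shows "prob_space (density lborel (\<lambda>x. ennreal (p x)))"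
proof
  have "(\<integral>\<^sup>+x. ennreal (p x) \<partial>lborel) = ennreal (integral\<^sup>L lborel p)"
    using assms by (intro nn_integral_eq_integral) (auto simp: prob_density_def)
  then show "emeasure (density lborel (\<lambda>x. ennreal (p x))) (space (density lborel (\<lambda>x. ennreal (p x)))) = 1"
    using assms prob_density_measurable[OF assms] by (simp add: emeasure_density prob_density_def)
qed

lemma density_singleton_null:
  fixes p :: "real^'n \<Rightarrow> ennreal"
  assumes "p \<in> borel_measurable borel"
  shows "emeasure (density lborel p) {x} = 0"
proof -
  have "{x} \<in> null_sets lborel" by (auto simp: null_sets_def)
  then have "{x} \<in> null_sets (density lborel p)"
    using assms AE_not_in[OF \<open>{x} \<in> null_sets lborel\<close>]
    by (subst null_sets_density_iff) (auto simp: frequently_def)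
  then show ?thesis by auto
qed

lemma hit_prob_density:
  assumes p: "prob_density p" and f: "f \<in> Cc"
  shows "hit f (density lborel (\<lambda>x. ennreal (p x))) q = (\<integral>x. p x * (1 - exp (- f (lat q + x))) \<partial>lborel)"
proof -
  note [measurable] = prob_density_measurable[OF p] Cc_borel_measurable[OF f]
  show ?thesis unfolding hit_def
    using p by (subst integral_density) (auto simp: prob_density_def)
qed

lemma pert_laplace_density:
  assumes p: "prob_density p" and f: "f \<in> Cc" and f0: "\<And>x. 0 \<le> f x"
  shows "(\<lambda>m. \<Prod>i<m. 1 - hit f (density lborel (\<lambda>x. ennreal (p x))) (enum_lat i))
    \<longlonglongrightarrow> (\<integral>S. exp (- pint f S) \<partial>pert_law (density lborel (\<lambda>x. ennreal (p x))))"
proof (rule pert_laplace[OF prob_space_prob_density[OF p] _ _ f f0])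
  note [measurable] = prob_density_measurable[OF p]
  show "emeasure (density lborel (\<lambda>x. ennreal (p x))) {x} = 0" for x
    by (rule density_singleton_null) measurable
qed simp

lemma hit_le_1:
  assumes p: "prob_density p" and f: "f \<in> Cc" and f0: "\<And>x. 0 \<le> f x"
  shows "hit f (density lborel (\<lambda>x. ennreal (p x))) q \<le> 1"
proof -
  note [measurable] = prob_density_measurable[OF p] Cc_borel_measurable[OF f]
  have ip: "integrable lborel p" using p by (simp add: prob_density_def)
  have p0: "0 \<le> p x" for x using p by (simp add: prob_density_def)
  have le: "p x * (1 - exp (- f (lat q + x))) \<le> p x" for x
    using p0[of x] f0[of "lat q + x"] by (intro mult_left_le) auto
  have "(\<integral>x. p x * (1 - exp (- f (lat q + x))) \<partial>lborel) \<le> integral\<^sup>L lborel p"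
  proof (rule integral_mono[OF _ ip le])
    show "integrable lborel (\<lambda>x. p x * (1 - exp (- f (lat q + x))))"
      by (rule Bochner_Integration.integrable_bound[OF ip]) (use p0 f0 le in \<open>auto intro!: AE_I2 simp: abs_mult\<close>)
  qed
  then show ?thesis using p hit_prob_density[OF p f] by (simp add: prob_density_def)
qed

lemma pert_laplace_diff_le:
  fixes p p' :: "real^'n \<Rightarrow> real"
  assumes p: "prob_density p" and p': "prob_density p'" and f: "f \<in> Cc" and f0: "\<And>x. 0 \<le> f x"
    and supp: "\<And>x. f x \<noteq> 0 \<Longrightarrow> norm x \<le> real n"
  shows "\<bar>(\<integral>S. exp (- pint f S) \<partial>pert_law (density lborel (\<lambda>x. ennreal (p x))))
      - (\<integral>S. exp (- pint f S) \<partial>pert_law (density lborel (\<lambda>x. ennreal (p' x))))\<bar>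
    \<le> lat_bound TYPE('n) n * (\<integral>x. \<bar>p x - p' x\<bar> \<partial>lborel)" (is "\<bar>?L - ?L'\<bar> \<le> ?C")
proof -
  let ?h = "\<lambda>i. hit f (density lborel (\<lambda>x. ennreal (p x))) (enum_lat i)"
  let ?h' = "\<lambda>i. hit f (density lborel (\<lambda>x. ennreal (p' x))) (enum_lat i)"
  let ?u = "\<lambda>y. 1 - exp (- f y)"
  note [measurable] = prob_density_measurable[OF p] prob_density_measurable[OF p'] Cc_borel_measurable[OF f]
  have ip: "integrable lborel p" "integrable lborel p'" using p p' by (auto simp: prob_density_def)
  have p0: "0 \<le> p x" "0 \<le> p' x" for x using p p' by (auto simp: prob_density_def)
  have u: "0 \<le> ?u y" "?u y \<le> 1" for y using f0[of y] by auto
  have int: "integrable lborel (\<lambda>x. g x * ?u (lat q + x))" if "integrable lborel g" for g :: "real^'n \<Rightarrow> real" and q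
  proof -
    have [measurable]: "g \<in> borel_measurable borel" using that by auto
    have "\<bar>g x\<bar> * ?u (lat q + x) \<le> \<bar>g x\<bar>" for x by (intro mult_left_le u) auto
    then show ?thesis
      by (intro Bochner_Integration.integrable_bound[OF that]) (use u in \<open>auto intro!: AE_I2 simp: abs_mult\<close>)
  qed
  have idiff: "integrable lborel (\<lambda>x. p x - p' x)" "integrable lborel (\<lambda>x. \<bar>p x - p' x\<bar>)" using ip by auto
  have bound: "\<bar>(\<Prod>i<m. 1 - ?h i) - (\<Prod>i<m. 1 - ?h' i)\<bar> \<le> ?C" for m
  proof -
    have hb: "\<bar>1 - ?h i\<bar> \<le> 1" "\<bar>1 - ?h' i\<bar> \<le> 1" for i
      using hit_nonneg[of f _ "enum_lat i", OF f0] hit_le_1[OF p f f0, of "enum_lat i"] hit_le_1[OF p' f f0, of "enum_lat i"]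
      by (auto simp: abs_le_iff)
    have "\<bar>(\<Prod>i<m. 1 - ?h i) - (\<Prod>i<m. 1 - ?h' i)\<bar> \<le> (\<Sum>i<m. \<bar>(1 - ?h i) - (1 - ?h' i)\<bar>)"
      using norm_prod_diff[of "{..<m}" "\<lambda>i. 1 - ?h i" "\<lambda>i. 1 - ?h' i"] hb by simp
    also have "\<dots> \<le> (\<Sum>i<m. \<integral>x. \<bar>p x - p' x\<bar> * ?u (lat (enum_lat i) + x) \<partial>lborel)"
    proof (rule sum_mono)
      fix i
      have "?h i - ?h' i = (\<integral>x. (p x - p' x) * ?u (lat (enum_lat i) + x) \<partial>lborel)"
        unfolding hit_prob_density[OF p f] hit_prob_density[OF p' f]
        by (simp only: left_diff_distrib Bochner_Integration.integral_diff[OF int[OF ip(1)] int[OF ip(2)]])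
      also have "\<bar>\<dots>\<bar> \<le> (\<integral>x. \<bar>(p x - p' x) * ?u (lat (enum_lat i) + x)\<bar> \<partial>lborel)"
        by (rule integral_abs_bound)
      also have "\<dots> = (\<integral>x. \<bar>p x - p' x\<bar> * ?u (lat (enum_lat i) + x) \<partial>lborel)"
        using u by (intro Bochner_Integration.integral_cong) (auto simp: abs_mult)
      finally show "\<bar>(1 - ?h i) - (1 - ?h' i)\<bar> \<le> (\<integral>x. \<bar>p x - p' x\<bar> * ?u (lat (enum_lat i) + x) \<partial>lborel)"
        by (simp add: abs_minus_commute)
    qed
    also have "\<dots> = (\<integral>x. (\<Sum>i<m. \<bar>p x - p' x\<bar> * ?u (lat (enum_lat i) + x)) \<partial>lborel)"
      by (subst Bochner_Integration.integral_sum) (auto intro!: int idiff)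
    also have "\<dots> \<le> (\<integral>x. lat_bound TYPE('n) n * \<bar>p x - p' x\<bar> \<partial>lborel)"
    proof (rule integral_mono)
      show "integrable lborel (\<lambda>x. \<Sum>i<m. \<bar>p x - p' x\<bar> * ?u (lat (enum_lat i) + x))"
        by (intro Bochner_Integration.integrable_sum int idiff)
      show "integrable lborel (\<lambda>x. lat_bound TYPE('n) n * \<bar>p x - p' x\<bar>)" using idiff by simp
      fix x :: "real^'n"
      have "(\<Sum>i<m. ?u (lat (enum_lat i) + x)) \<le> lat_bound TYPE('n) n"
      proof (rule lat_sum_le[of ?u])
        show "norm y \<le> real n" if "?u y \<noteq> 0" for y using supp[of y] that by (cases "f y = 0") auto
      qed (rule u)
      then have "(\<Sum>i<m. ?u (lat (enum_lat i) + x)) * \<bar>p x - p' x\<bar> \<le> lat_bound TYPE('n) n * \<bar>p x - p' x\<bar>"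
        by (rule mult_right_mono) simp
      then show "(\<Sum>i<m. \<bar>p x - p' x\<bar> * ?u (lat (enum_lat i) + x)) \<le> lat_bound TYPE('n) n * \<bar>p x - p' x\<bar>"
        by (simp add: sum_distrib_left mult.commute)
    qed
    finally show ?thesis by simp
  qed
  have "(\<lambda>m. \<bar>(\<Prod>i<m. 1 - ?h i) - (\<Prod>i<m. 1 - ?h' i)\<bar>) \<longlonglongrightarrow> \<bar>?L - ?L'\<bar>"
    by (intro tendsto_intros pert_laplace_density p p' f f0)
  then show ?thesis using bound by (intro LIMSEQ_le_const2) auto
qed

definition expker :: "real \<Rightarrow> real^'n \<Rightarrow> real" where
  "expker \<theta> x = exp (- (norm x powr \<theta>))"

definition norm_const :: "'n::finite itself \<Rightarrow> real \<Rightarrow> real" where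
  "norm_const _ \<theta> = integral\<^sup>L lborel (expker \<theta> :: real^'n \<Rightarrow> real)"

lemma expker_measurable [measurable]: "expker \<theta> \<in> borel_measurable borel"
  unfolding expker_def[abs_def] by measurable

lemma expker_bounds: "0 < expker \<theta> x" "expker \<theta> x \<le> 1"
  by (auto simp: expker_def)

lemma expker_integrable:
  assumes \<theta>: "0 < \<theta>"
  shows "integrable lborel (expker \<theta> :: real^'n \<Rightarrow> real)"
proof (rule integrableI_bounded)
  let ?d = "DIM(real^'n)" and ?V = "unit_ball_vol (DIM(real^'n))"
  let ?a = "\<lambda>k::nat. exp (- (real k powr \<theta>)) * (?V * (real k + 1) ^ ?d)"
  have "(\<lambda>k::nat. exp (- (real k powr \<theta>)) * (real k + 1) powr real ?d) \<in> O(\<lambda>k. real k powr -2)"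
    using \<theta> by real_asymp
  then have "summable (\<lambda>k::nat. exp (- (real k powr \<theta>)) * (real k + 1) powr real ?d)"
    by (rule summable_comparison_test_bigo[rotated]) (simp add: summable_real_powr_iff)
  then have "summable (\<lambda>k::nat. ?V * (exp (- (real k powr \<theta>)) * (real k + 1) powr real ?d))"
    by (rule summable_mult)
  then have sm: "summable ?a" by (simp add: powr_realpow algebra_simps)
  have "(\<integral>\<^sup>+x. ennreal (norm (expker \<theta> (x::real^'n))) \<partial>lborel)
    \<le> (\<integral>\<^sup>+x. (\<Sum>k. ennreal (exp (- (real k powr \<theta>))) * indicator (cball (0::real^'n) (real k + 1)) x) \<partial>lborel)"
  proof (rule nn_integral_mono)
    fix x :: "real^'n"
    define k where "k = nat \<lfloor>norm x\<rfloor>"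
    have k: "real k \<le> norm x" "norm x \<le> real k + 1" using norm_ge_zero[of x] unfolding k_def by linarith+
    have "ennreal (norm (expker \<theta> x)) \<le> ennreal (exp (- (real k powr \<theta>))) * indicator (cball 0 (real k + 1)) x"
      using k \<theta> by (auto simp: expker_def intro!: powr_mono2)
    also have "\<dots> = (\<Sum>k\<in>{k}. ennreal (exp (- (real k powr \<theta>))) * indicator (cball (0::real^'n) (real k + 1)) x)"
      by (simp only: sum.insert[OF finite.emptyI] empty_iff not_False_eq_True sum.empty add_0_right)
    also have "\<dots> \<le> (\<Sum>k. ennreal (exp (- (real k powr \<theta>))) * indicator (cball (0::real^'n) (real k + 1)) x)"
      by (rule sum_le_suminf) auto
    finally show "ennreal (norm (expker \<theta> x)) \<le> \<dots>" .
  qed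
  also have "\<dots> = (\<Sum>k. \<integral>\<^sup>+x. ennreal (exp (- (real k powr \<theta>))) * indicator (cball (0::real^'n) (real k + 1)) x \<partial>lborel)"
    by (intro nn_integral_suminf borel_measurable_times_ennreal borel_measurable_const borel_measurable_indicator) auto
  also have "\<dots> = (\<Sum>k. ennreal (?a k))"
    by (intro suminf_cong) (simp add: nn_integral_cmult_indicator emeasure_cball ennreal_mult)
  also have "\<dots> < \<infinity>"
    unfolding infinity_ennreal_def less_top[symmetric] by (rule ennreal_suminf_neq_top[OF sm]) simp
  finally show "(\<integral>\<^sup>+x. ennreal (norm (expker \<theta> (x::real^'n))) \<partial>lborel) < \<infinity>" .
qed simp

lemma norm_const_ge:
  assumes \<theta>: "0 < \<theta>" and R: "0 \<le> R"
  shows "exp (- (R powr \<theta>)) * (unit_ball_vol (DIM(real^'n)) * R ^ DIM(real^'n)) \<le> norm_const TYPE('n) \<theta>"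
proof -
  have "(\<integral>x. exp (- (R powr \<theta>)) * indicator (cball (0::real^'n) R) x \<partial>lborel) \<le> norm_const TYPE('n) \<theta>"
    unfolding norm_const_def
  proof (rule integral_mono)
    show "integrable lborel (expker \<theta> :: real^'n \<Rightarrow> real)" by (rule expker_integrable[OF \<theta>])
    show "integrable lborel (\<lambda>x. exp (- (R powr \<theta>)) * indicator (cball (0::real^'n) R) x :: real)"
      using R by (intro integrable_mult_right integrable_real_indicator) (auto simp: emeasure_cball)
    show "exp (- (R powr \<theta>)) * indicator (cball (0::real^'n) R) x \<le> expker \<theta> x" for x :: "real^'n"
      using \<theta> by (auto simp: indicator_def expker_def intro!: powr_mono2)
  qed
  then show ?thesis using R by (simp add: content_cball)
qed

lemma norm_const_pos:
  assumes "0 < \<theta>" shows "0 < norm_const TYPE('n::finite) \<theta>"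
proof -
  have "0 < exp (- (1 powr \<theta>)) * (unit_ball_vol (DIM(real^'n)) * 1 ^ DIM(real^'n))"
    by (intro mult_pos_pos unit_ball_vol_pos) auto
  then show ?thesis using norm_const_ge[OF assms, of 1, where 'n = 'n] by linarith
qed

lemma dens_eq: "dens \<theta> x = expker \<theta> x / norm_const TYPE('n) \<theta>" for x :: "real^'n"
  unfolding dens_def expker_def norm_const_def by (simp add: expker_def)

lemma prob_density_dens:
  assumes "0 < \<theta>" shows "prob_density (dens \<theta> :: real^'n \<Rightarrow> real)"
proof -
  have eq: "(dens \<theta> :: real^'n \<Rightarrow> real) = (\<lambda>x. expker \<theta> x / norm_const TYPE('n) \<theta>)" by (auto simp: dens_eq)
  show ?thesis unfolding prob_density_def eq
    using expker_integrable[OF assms, where 'n = 'n] norm_const_pos[OF assms, where 'n = 'n]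
      less_imp_le[OF expker_bounds(1)[of \<theta>, where 'a = 'n]]
    by (auto simp: norm_const_def)
qed

lemma Ptheta_eq: "Ptheta \<theta> = pert_law (density lborel (\<lambda>x. ennreal (dens \<theta> x)))"
  by (simp add: Ptheta_def pert_law_def)

lemma prob_Xi_Ptheta: "0 < \<theta> \<Longrightarrow> prob_Xi (Ptheta \<theta> :: (real^'n) set measure)"
  unfolding Ptheta_eq by (intro prob_Xi_pert_law prob_space_prob_density prob_density_dens) auto

section \<open>The limit for large exponents\<close>

lemma AE_norm_neq: "AE x in lborel. norm (x::real^'n) \<noteq> r"
proof -
  have "sphere (0::real^'n) r \<in> null_sets lborel"
    using negligible_sphere[of "0::real^'n" r]
    by (auto simp: null_sets_completion_iff negligible_iff_null_sets)
  then show ?thesis by (rule AE_I') auto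
qed

lemma expker_tendsto_ball:
  assumes "norm x \<noteq> 1"
  shows "((\<lambda>\<theta>. expker \<theta> x) \<longlongrightarrow> indicator (ball 0 1) x) at_top"
proof -
  consider "x = 0" | "0 < norm x" "norm x < 1" | "1 < norm x" using assms by fastforce
  then show ?thesis
  proof cases
    case 1
    then show ?thesis by (simp add: expker_def)
  next
    case 2
    then have "((\<lambda>\<theta>. norm x powr \<theta>) \<longlongrightarrow> 0) at_top" by real_asymp
    from tendsto_exp[OF tendsto_minus[OF this]] show ?thesis using 2 by (simp add: expker_def)
  next
    case 3
    then have "0 < ln (norm x)" by (rule ln_gt_zero)
    then have "filterlim (\<lambda>\<theta>. exp (\<theta> * ln (norm x))) at_top at_top" by real_asymp
    then have "filterlim (\<lambda>\<theta>. norm x powr \<theta>) at_top at_top" using 3 by (cases "x = 0") (auto simp: powr_def)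
    then have "((\<lambda>\<theta>. exp (- (norm x powr \<theta>))) \<longlongrightarrow> 0) at_top"
      by (intro filterlim_compose[OF exp_at_bot]) (simp add: filterlim_uminus_at_top)
    then show ?thesis using 3 by (simp add: expker_def)
  qed
qed

definition ball_dens :: "real^'n \<Rightarrow> real" where
  "ball_dens x = indicator (ball 0 1) x / measure lborel (ball (0::real^'n) 1)"

lemma measure_unit_ball_pos: "0 < measure lborel (ball (0::real^'n) 1)"
  by (subst content_ball) auto

lemma integrable_indicator_ball: "integrable lborel (indicator (ball (0::real^'n) r) :: _ \<Rightarrow> real)"
  by (intro integrable_real_indicator emeasure_bounded_finite) auto

lemma prob_density_ball_dens: "prob_density (ball_dens :: real^'n \<Rightarrow> real)"
  unfolding prob_density_def ball_dens_def[abs_def]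
  using measure_unit_ball_pos[where 'n = 'n] integrable_indicator_ball[of 1, where 'n = 'n] by (auto simp: less_imp_le)

lemma Pinf_eq: "Pinf = pert_law (density lborel (\<lambda>x::real^'n. ennreal (ball_dens x)))"
proof -
  have "indicator (ball 0 1) x / emeasure lborel (ball (0::real^'n) 1) = ennreal (ball_dens x)" for x :: "real^'n"
  proof -
    have "emeasure lborel (ball (0::real^'n) 1) = ennreal (measure lborel (ball (0::real^'n) 1))"
      by (intro emeasure_eq_ennreal_measure) (use emeasure_bounded_finite[of "ball (0::real^'n) 1"] in auto)
    then show ?thesis using measure_unit_ball_pos[where 'n = 'n]
      by (auto simp: ball_dens_def indicator_def divide_ennreal simp flip: ennreal_1)
  qed
  then show ?thesis by (simp add: Pinf_def pert_law_def uniform_measure_def)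
qed

lemma dens_tendsto_L1:
  "((\<lambda>\<theta>. \<integral>x. \<bar>dens \<theta> x - ball_dens (x::real^'n)\<bar> \<partial>lborel) \<longlongrightarrow> 0) at_top"
proof -
  let ?I = "\<lambda>x::real^'n. indicator (ball 0 1) x :: real"
  define V where "V = measure lborel (ball (0::real^'n) 1)"
  define D where "D \<theta> = (\<integral>x. \<bar>expker \<theta> x - ?I x\<bar> \<partial>lborel)" for \<theta>
  have [measurable]: "ball (0::real^'n) 1 \<in> sets borel" by simp
  have V: "0 < V" unfolding V_def by (rule measure_unit_ball_pos)
  have intI: "integrable lborel ?I" by (rule integrable_indicator_ball)
  have VI: "V = integral\<^sup>L lborel ?I" by (simp add: V_def)
  have "((\<lambda>\<theta>. \<integral>x. \<bar>expker \<theta> x - ?I x\<bar> \<partial>lborel) \<longlongrightarrow> (\<integral>x. 0 \<partial>(lborel::(real^'n) measure))) at_top"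
  proof (rule integral_dominated_convergence_at_top[where w = "\<lambda>x. expker 1 x + indicator (ball 0 2) x"])
    show "integrable lborel (\<lambda>x::real^'n. expker 1 x + indicator (ball 0 2) x)"
      using expker_integrable[of 1, where 'n = 'n] integrable_indicator_ball[of 2, where 'n = 'n] by simp
    show "\<forall>\<^sub>F \<theta> in at_top. AE x in lborel. norm \<bar>expker \<theta> x - ?I x\<bar> \<le> expker 1 x + indicator (ball 0 2) x"
      using eventually_ge_at_top[of 1]
    proof eventually_elim
      case (elim \<theta>)
      show ?case
      proof (rule AE_I2)
        fix x :: "real^'n"
        note b = expker_bounds[of \<theta> x] expker_bounds[of 1 x]
        show "norm \<bar>expker \<theta> x - ?I x\<bar> \<le> expker 1 x + indicator (ball 0 2) x"
        proof (cases "norm x < 2")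
          case True
          then show ?thesis using b by (auto simp: indicator_def abs_le_iff)
        next
          case False
          then have "norm x powr 1 \<le> norm x powr \<theta>" using elim by (intro powr_mono) auto
          then have "expker \<theta> x \<le> expker 1 x" by (simp add: expker_def)
          then show ?thesis using b False by (auto simp: indicator_def)
        qed
      qed
    qed
    show "AE x in lborel. ((\<lambda>\<theta>. \<bar>expker \<theta> x - ?I x\<bar>) \<longlongrightarrow> 0) at_top"
      using AE_norm_neq[of 1]
    proof eventually_elim
      case (elim x)
      have "((\<lambda>\<theta>. \<bar>expker \<theta> x - ?I x\<bar>) \<longlongrightarrow> \<bar>?I x - ?I x\<bar>) at_top"
        by (intro tendsto_intros expker_tendsto_ball elim)
      then show ?case by simp
    qed
    show "(\<lambda>x. \<bar>expker \<theta> x - ?I x\<bar>) \<in> borel_measurable lborel" for \<theta> by measurable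
  qed simp
  then have D0: "(D \<longlongrightarrow> 0) at_top" unfolding D_def by simp
  have le: "(\<integral>x. \<bar>dens \<theta> x - ball_dens (x::real^'n)\<bar> \<partial>lborel) \<le> 2 * D \<theta> / V" if \<theta>: "0 < \<theta>" for \<theta>
  proof -
    let ?Z = "norm_const TYPE('n) \<theta>"
    have Z: "0 < ?Z" by (rule norm_const_pos[OF \<theta>])
    note ik = expker_integrable[OF \<theta>, where 'n = 'n]
    have ZV: "\<bar>?Z - V\<bar> \<le> D \<theta>"
    proof -
      have "?Z - V = (\<integral>x. expker \<theta> x - ?I x \<partial>lborel)"
        unfolding norm_const_def VI using ik intI by simp
      then show ?thesis unfolding D_def using integral_abs_bound[of lborel "\<lambda>x. expker \<theta> x - ?I x"] by simp
    qed
    have pt: "\<bar>dens \<theta> x - ball_dens x\<bar> \<le> \<bar>expker \<theta> x - ?I x\<bar> / V + expker \<theta> x * (\<bar>?Z - V\<bar> / (?Z * V))" for x :: "real^'n"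
    proof -
      have "dens \<theta> x - ball_dens x = (expker \<theta> x - ?I x) / V - expker \<theta> x * ((?Z - V) / (?Z * V))"
        unfolding dens_eq ball_dens_def V_def[symmetric] using Z V by (simp add: field_simps)
      also have "\<bar>\<dots>\<bar> \<le> \<bar>(expker \<theta> x - ?I x) / V\<bar> + \<bar>expker \<theta> x * ((?Z - V) / (?Z * V))\<bar>" by (rule abs_triangle_ineq4)
      also have "\<dots> = \<bar>expker \<theta> x - ?I x\<bar> / V + expker \<theta> x * (\<bar>?Z - V\<bar> / (?Z * V))"
        using Z V expker_bounds[of \<theta> x] by (simp add: abs_mult)
      finally show ?thesis .
    qed
    have "(\<integral>x. \<bar>dens \<theta> x - ball_dens (x::real^'n)\<bar> \<partial>lborel)
      \<le> (\<integral>x. \<bar>expker \<theta> x - ?I x\<bar> / V + expker \<theta> x * (\<bar>?Z - V\<bar> / (?Z * V)) \<partial>lborel)"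
    proof (rule integral_mono[OF _ _ pt])
      show "integrable lborel (\<lambda>x::real^'n. \<bar>dens \<theta> x - ball_dens x\<bar>)"
        using prob_density_dens[OF \<theta>, where 'n = 'n] prob_density_ball_dens[where 'n = 'n]
        by (auto simp: prob_density_def)
      show "integrable lborel (\<lambda>x. \<bar>expker \<theta> x - ?I x\<bar> / V + expker \<theta> x * (\<bar>?Z - V\<bar> / (?Z * V)))"
        using ik intI by (intro Bochner_Integration.integrable_add integrable_divide integrable_mult_left integrable_abs Bochner_Integration.integrable_diff)
    qed
    also have "\<dots> = D \<theta> / V + ?Z * (\<bar>?Z - V\<bar> / (?Z * V))"
      unfolding D_def norm_const_def using ik intI by simp
    also have "\<dots> = D \<theta> / V + \<bar>?Z - V\<bar> / V" using Z by simp
    also have "\<dots> \<le> D \<theta> / V + D \<theta> / V" using ZV V by (intro add_left_mono divide_right_mono) auto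
    finally show ?thesis by simp
  qed
  show ?thesis
  proof (rule tendsto_sandwich[OF _ _ tendsto_const])
    show "((\<lambda>\<theta>. 2 * D \<theta> / V) \<longlongrightarrow> 0) at_top"
      using tendsto_divide[OF tendsto_mult[OF tendsto_const[of 2] D0] tendsto_const[of V]] V by simp
    show "\<forall>\<^sub>F \<theta> in at_top. (\<integral>x. \<bar>dens \<theta> x - ball_dens (x::real^'n)\<bar> \<partial>lborel) \<le> 2 * D \<theta> / V"
      using eventually_gt_at_top[of 0] by eventually_elim (rule le)
  qed simp
qed

lemma Ptheta_tendsto_Pinf: "weak_conv_Xi (Ptheta :: real \<Rightarrow> (real^'n) set measure) Pinf at_top"
proof (rule weak_conv_XiI_laplace)
  show "\<forall>\<^sub>F \<theta> in at_top. prob_Xi (Ptheta \<theta> :: (real^'n) set measure)"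
    using eventually_gt_at_top[of 0] by eventually_elim (rule prob_Xi_Ptheta)
  show "prob_Xi (Pinf :: (real^'n) set measure)"
    unfolding Pinf_eq by (intro prob_Xi_pert_law prob_space_prob_density prob_density_ball_dens) auto
  fix f :: "real^'n \<Rightarrow> real" assume f: "f \<in> Cc" and f0: "\<And>x. 0 \<le> f x"
  obtain n :: nat where n: "\<And>x. f x \<noteq> 0 \<Longrightarrow> norm x \<le> real n" using Cc_support f by blast
  let ?L = "\<lambda>P. \<integral>S. exp (- pint f S) \<partial>P"
  have "((\<lambda>\<theta>. ?L (Ptheta \<theta>) - ?L Pinf) \<longlongrightarrow> 0) at_top"
  proof (rule Lim_null_comparison)
    show "\<forall>\<^sub>F \<theta> in at_top. norm (?L (Ptheta \<theta>) - ?L Pinf) \<le> lat_bound TYPE('n) n * (\<integral>x. \<bar>dens \<theta> x - ball_dens (x::real^'n)\<bar> \<partial>lborel)"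
      using eventually_gt_at_top[of 0]
    proof eventually_elim
      case (elim \<theta>)
      then show ?case unfolding Ptheta_eq Pinf_eq real_norm_def
        by (intro pert_laplace_diff_le prob_density_dens prob_density_ball_dens f f0 n)
    qed
    show "((\<lambda>\<theta>. lat_bound TYPE('n) n * (\<integral>x. \<bar>dens \<theta> x - ball_dens (x::real^'n)\<bar> \<partial>lborel)) \<longlongrightarrow> 0) at_top"
      using tendsto_mult[OF tendsto_const dens_tendsto_L1] by simp
  qed
  then show "((\<lambda>\<theta>. ?L (Ptheta \<theta>)) \<longlongrightarrow> ?L Pinf) at_top" by (simp add: LIM_zero_iff)
qed

section \<open>The limit for small exponents\<close>

lemma expker_nonneg: "0 \<le> expker \<theta> x"
  by (simp add: expker_def)

lemma nn_integral_lborel_shift: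
  fixes h :: "'a::euclidean_space \<Rightarrow> ennreal"
  assumes [measurable]: "h \<in> borel_measurable borel"
  shows "(\<integral>\<^sup>+v. h (c + v) \<partial>lborel) = (\<integral>\<^sup>+y. h y \<partial>lborel)"
proof -
  have "(\<integral>\<^sup>+y. h y \<partial>lborel) = (\<integral>\<^sup>+y. h y \<partial>distr lborel borel ((+) c))" by (simp add: lborel_distr_plus)
  also have "\<dots> = (\<integral>\<^sup>+v. h (c + v) \<partial>lborel)" by (rule nn_integral_distr) auto
  finally show ?thesis ..
qed

lemma unit_cube_measurable [measurable]: "(unit_cube :: (real^'n) set) \<in> sets borel"
proof -
  have "unit_cube = (\<Inter>i. {x::real^'n. 0 \<le> x $ i} \<inter> {x. x $ i < 1})" by (auto simp: unit_cube_def)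
  also have "\<dots> \<in> sets borel"
    by (intro sets.finite_INT sets.Int borel_closed borel_open closed_Collect_le open_Collect_less continuous_intros) auto
  finally show ?thesis .
qed

lemma emeasure_unit_cube: "emeasure lborel (unit_cube :: (real^'n) set) = 1"
proof (rule antisym)
  let ?one = "(\<chi> i. 1) :: real^'n"
  have one: "?one \<bullet> b = 1" "(0::real^'n) \<bullet> b \<le> ?one \<bullet> b" if "b \<in> Basis" for b
    using that by (auto simp: Basis_vec_def inner_axis)
  have "(unit_cube :: (real^'n) set) \<subseteq> cbox 0 ?one" by (auto simp: unit_cube_def mem_box_cart less_imp_le)
  then have "emeasure lborel (unit_cube :: (real^'n) set) \<le> emeasure lborel (cbox 0 ?one)" by (intro emeasure_mono) auto
  also have "\<dots> = 1" using one by (simp add: emeasure_lborel_cbox_eq)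
  finally show "emeasure lborel (unit_cube :: (real^'n) set) \<le> 1" .
  have "1 = emeasure lborel (box 0 ?one)" using one by (simp add: emeasure_lborel_box_eq)
  also have "\<dots> \<le> emeasure lborel (unit_cube :: (real^'n) set)"
    by (intro emeasure_mono) (auto simp: unit_cube_def mem_box_cart less_imp_le)
  finally show "1 \<le> emeasure lborel (unit_cube :: (real^'n) set)" .
qed

lemma norm_unit_cube_le:
  assumes "(v::real^'n) \<in> unit_cube" shows "norm v \<le> real CARD('n)"
proof -
  have "norm v \<le> (\<Sum>i\<in>UNIV. \<bar>v $ i\<bar>)" by (rule norm_le_l1_cart)
  also have "\<dots> \<le> (\<Sum>i\<in>(UNIV::'n set). 1)"
    using assms by (intro sum_mono) (auto simp: unit_cube_def less_imp_le)
  finally show ?thesis by simp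
qed

lemma diff_lat_in_unit_cube_iff: "y - lat q \<in> unit_cube \<longleftrightarrow> q = (\<chi> i. \<lfloor>y $ i\<rfloor>)"
proof -
  have "0 \<le> y $ i - real_of_int (q $ i) \<and> y $ i - real_of_int (q $ i) < 1 \<longleftrightarrow> q $ i = \<lfloor>y $ i\<rfloor>" for i
    by (subst eq_commute, subst floor_eq_iff) auto
  then show ?thesis by (simp add: unit_cube_def lat_def vec_eq_iff)
qed

lemma suminf_indicator_unit_cube:
  fixes y :: "real^'n"
  shows "(\<Sum>i. indicator unit_cube (y - lat (enum_lat i)) :: ennreal) = 1"
proof -
  obtain k where k: "enum_lat k = ((\<chi> i. \<lfloor>y $ i\<rfloor>) :: int^'n)"
    using bij_is_surj[OF bij_enum_lat] by (metis surj_def)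
  have "y - lat (enum_lat i) \<in> unit_cube \<longleftrightarrow> i = k" for i
    unfolding diff_lat_in_unit_cube_iff k[symmetric] using inj_enum_lat by (auto dest: injD)
  then have "(\<Sum>i. indicator unit_cube (y - lat (enum_lat i)) :: ennreal) = (\<Sum>i\<in>{k}. 1)"
    by (subst suminf_finite[of "{k}"]) auto
  then show ?thesis by simp
qed

lemma nn_integral_tiling:
  fixes h :: "real^'n \<Rightarrow> ennreal"
  assumes [measurable]: "h \<in> borel_measurable borel"
  shows "(\<integral>\<^sup>+y. h y \<partial>lborel) = (\<Sum>i. \<integral>\<^sup>+v. h (lat (enum_lat i) + v) * indicator unit_cube v \<partial>lborel)"
proof -
  have "(\<integral>\<^sup>+y. h y \<partial>lborel) = (\<integral>\<^sup>+y. (\<Sum>i. h y * indicator unit_cube (y - lat (enum_lat i))) \<partial>lborel)"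
    by (simp add: ennreal_suminf_cmult suminf_indicator_unit_cube)
  also have "\<dots> = (\<Sum>i. \<integral>\<^sup>+y. h y * indicator unit_cube (y - lat (enum_lat i)) \<partial>lborel)"
    by (rule nn_integral_suminf) measurable
  also have "\<dots> = (\<Sum>i. \<integral>\<^sup>+v. h (lat (enum_lat i) + v) * indicator unit_cube (lat (enum_lat i) + v - lat (enum_lat i)) \<partial>lborel)"
    by (intro suminf_cong nn_integral_lborel_shift[symmetric]) measurable
  finally show ?thesis by simp
qed

lemma powr_diff_le:
  fixes r s :: real
  assumes \<theta>: "0 < \<theta>" "\<theta> \<le> 1" and r: "1 \<le> r" and rs: "s \<le> r + c" and c: "0 \<le> c" and s: "0 \<le> s"
  shows "s powr \<theta> \<le> r powr \<theta> + \<theta> * c"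
proof (cases "s \<le> r")
  case True
  then have "s powr \<theta> \<le> r powr \<theta>" using \<theta> s by (intro powr_mono2) auto
  moreover have "0 \<le> \<theta> * c" using \<theta> c by simp
  ultimately show ?thesis by linarith
next
  case False
  have "\<exists>z>r. z < s \<and> s powr \<theta> - r powr \<theta> = (s - r) * (\<theta> * z powr (\<theta> - 1))"
    using False r has_real_derivative_powr by (intro MVT2) auto
  then obtain z where z: "r < z" "s powr \<theta> - r powr \<theta> = (s - r) * (\<theta> * z powr (\<theta> - 1))" by blast
  have "z powr (\<theta> - 1) \<le> z powr 0" using z r \<theta> by (intro powr_mono) auto
  then have "z powr (\<theta> - 1) \<le> 1" using z r by simp
  then have "\<theta> * z powr (\<theta> - 1) \<le> \<theta> * 1" using \<theta> by (intro mult_left_mono) auto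
  then have "(s - r) * (\<theta> * z powr (\<theta> - 1)) \<le> c * \<theta>" using False rs \<theta> c by (intro mult_mono) auto
  then show ?thesis using z by (simp add: mult.commute)
qed

lemma expker_shift:
  fixes x x' :: "real^'n"
  assumes \<theta>: "0 < \<theta>" "\<theta> \<le> 1" and c: "norm (x - x') \<le> c"
  shows "expker \<theta> x \<le> exp (\<theta> * c) * expker \<theta> x' + indicator (cball 0 (1 + c)) x"
proof (cases "norm x \<le> 1 + c")
  case True
  have "0 \<le> exp (\<theta> * c) * expker \<theta> x'" using expker_bounds[of \<theta> x'] by simp
  then show ?thesis using True expker_bounds[of \<theta> x] by simp
next
  case False
  have c0: "0 \<le> c" using c norm_ge_zero order.trans by blast
  have "norm x' \<le> norm x + c" using c norm_triangle_ineq2[of x' x] by (simp add: norm_minus_commute)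
  then have "norm x' powr \<theta> \<le> norm x powr \<theta> + \<theta> * c"
    using False c0 by (intro powr_diff_le \<theta>) auto
  then have "exp (- (norm x powr \<theta>)) \<le> exp (\<theta> * c - norm x' powr \<theta>)" by simp
  also have "\<dots> = exp (\<theta> * c) * exp (- (norm x' powr \<theta>))" by (simp add: mult_exp_exp)
  finally show ?thesis using False by (simp add: expker_def)
qed

text \<open>Comparing each term \<open>expker \<theta> (y - lat q)\<close> with its average over the unit cube at \<open>q\<close>: up to the factor
  \<open>exp (\<theta> * d)\<close> and a bounded error coming from points near the origin, the lattice sum equals the integral.\<close>

lemma lattice_sum_bounds:
  fixes y :: "real^'n"
  assumes \<theta>: "0 < \<theta>" "\<theta> \<le> 1"
  defines "c \<equiv> real CARD('n)"
  defines "V \<equiv> measure lborel (cball (0::real^'n) (1 + 2 * c))"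
  shows "(\<Sum>i. ennreal (expker \<theta> (y - lat (enum_lat i)))) \<le> ennreal (exp (\<theta> * c) * norm_const TYPE('n) \<theta> + V)"
    and "ennreal (norm_const TYPE('n) \<theta>) \<le> ennreal (exp (\<theta> * c)) * (\<Sum>i. ennreal (expker \<theta> (y - lat (enum_lat i)))) + ennreal V"
proof -
  let ?Z = "norm_const TYPE('n) \<theta>"
  let ?B = "cball (0::real^'n) (1 + 2 * c)"
  let ?q = "\<lambda>i. lat (enum_lat i) :: real^'n"
  have c0: "0 \<le> c" by (simp add: c_def)
  have [measurable]: "?B \<in> sets borel" by simp
  have Z: "(\<integral>\<^sup>+z. ennreal (expker \<theta> (y - z)) \<partial>lborel) = ennreal ?Z"
  proof -
    have "(\<integral>\<^sup>+z. ennreal (expker \<theta> (y - z)) \<partial>lborel) = (\<integral>\<^sup>+z. ennreal (expker \<theta> (- y + z)) \<partial>lborel)"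
      by (intro nn_integral_cong) (simp add: expker_def norm_minus_commute add.commute)
    also have "\<dots> = (\<integral>\<^sup>+z. ennreal (expker \<theta> (z::real^'n)) \<partial>lborel)" by (rule nn_integral_lborel_shift) measurable
    also have "\<dots> = ennreal ?Z" unfolding norm_const_def
      using expker_integrable[OF \<theta>(1), where 'n = 'n] by (intro nn_integral_eq_integral) (auto simp: expker_nonneg)
    finally show ?thesis .
  qed
  have V: "(\<integral>\<^sup>+z. indicator ?B (y - z) \<partial>lborel) = ennreal V"
  proof -
    have "(\<integral>\<^sup>+z. indicator ?B (y - z) \<partial>lborel) = (\<integral>\<^sup>+z. indicator ?B (- y + z) \<partial>lborel)"
      by (intro nn_integral_cong) (simp add: indicator_def norm_minus_commute add.commute)
    also have "\<dots> = (\<integral>\<^sup>+z. indicator ?B z \<partial>lborel)" by (rule nn_integral_lborel_shift) measurable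
    also have "\<dots> = emeasure lborel ?B" by simp
    also have "\<dots> = ennreal V" unfolding V_def
      by (intro emeasure_eq_ennreal_measure) (use emeasure_bounded_finite[of ?B] in auto)
    finally show ?thesis .
  qed
  have shift1: "expker \<theta> (y - ?q i) \<le> exp (\<theta> * c) * expker \<theta> (y - (?q i + v)) + indicator ?B (y - (?q i + v))"
    if v: "v \<in> unit_cube" for i v
  proof -
    have nv: "norm v \<le> c" unfolding c_def by (rule norm_unit_cube_le[OF v])
    have "expker \<theta> (y - ?q i) \<le> exp (\<theta> * c) * expker \<theta> (y - (?q i + v)) + indicator (cball 0 (1 + c)) (y - ?q i)"
      using nv by (intro expker_shift \<theta>) simp
    moreover have "norm (y - (?q i + v)) \<le> norm (y - ?q i) + norm v"
      using norm_triangle_ineq4[of "y - ?q i" v] by (simp add: algebra_simps)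
    then have "indicator (cball 0 (1 + c)) (y - ?q i) \<le> (indicator ?B (y - (?q i + v)) :: real)"
      using nv by (auto simp: indicator_def)
    ultimately show ?thesis by linarith
  qed
  have shift2: "expker \<theta> (y - (?q i + v)) \<le> exp (\<theta> * c) * expker \<theta> (y - ?q i) + indicator ?B (y - (?q i + v))"
    if v: "v \<in> unit_cube" for i v
  proof -
    have nv: "norm v \<le> c" unfolding c_def by (rule norm_unit_cube_le[OF v])
    have "expker \<theta> (y - (?q i + v)) \<le> exp (\<theta> * c) * expker \<theta> (y - ?q i) + indicator (cball 0 (1 + c)) (y - (?q i + v))"
      using nv by (intro expker_shift \<theta>) simp
    moreover have "indicator (cball 0 (1 + c)) (y - (?q i + v)) \<le> (indicator ?B (y - (?q i + v)) :: real)"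
      using c0 by (auto simp: indicator_def)
    ultimately show ?thesis by linarith
  qed
  have cube: "(\<integral>\<^sup>+v. a * indicator (unit_cube::(real^'n) set) v \<partial>lborel) = a" for a :: ennreal
    by (simp add: nn_integral_cmult_indicator emeasure_unit_cube)
  have ind: "ennreal (indicator A (z::real^'n)) = indicator A z" for A z by (simp add: indicator_def)
  have "(\<Sum>i. ennreal (expker \<theta> (y - ?q i))) = (\<Sum>i. \<integral>\<^sup>+v. ennreal (expker \<theta> (y - ?q i)) * indicator (unit_cube::(real^'n) set) v \<partial>lborel)"
    by (simp only: cube)
  also have "\<dots> \<le> (\<Sum>i. \<integral>\<^sup>+v. (ennreal (exp (\<theta> * c)) * ennreal (expker \<theta> (y - (?q i + v))) + indicator ?B (y - (?q i + v))) * indicator unit_cube v \<partial>lborel)"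
  proof (intro suminf_le summableI nn_integral_mono)
    fix i v
    show "ennreal (expker \<theta> (y - ?q i)) * indicator unit_cube v \<le>
      (ennreal (exp (\<theta> * c)) * ennreal (expker \<theta> (y - (?q i + v))) + indicator ?B (y - (?q i + v))) * indicator unit_cube v"
    proof (cases "v \<in> unit_cube")
      case True
      have "ennreal (expker \<theta> (y - ?q i)) \<le> ennreal (exp (\<theta> * c) * expker \<theta> (y - (?q i + v)) + indicator ?B (y - (?q i + v)))"
        by (rule ennreal_leI[OF shift1[OF True]])
      also have "\<dots> = ennreal (exp (\<theta> * c)) * ennreal (expker \<theta> (y - (?q i + v))) + indicator ?B (y - (?q i + v))"
        by (subst ennreal_plus) (auto simp: ennreal_mult ind expker_nonneg)
      finally show ?thesis using True by simp
    qed simp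
  qed
  also have "\<dots> = (\<integral>\<^sup>+z. ennreal (exp (\<theta> * c)) * ennreal (expker \<theta> (y - z)) + indicator ?B (y - z) \<partial>lborel)"
    by (rule nn_integral_tiling[symmetric]) measurable
  also have "\<dots> = ennreal (exp (\<theta> * c)) * (\<integral>\<^sup>+z. ennreal (expker \<theta> (y - z)) \<partial>lborel) + (\<integral>\<^sup>+z. indicator ?B (y - z) \<partial>lborel)"
    by (subst nn_integral_add) (auto simp: nn_integral_cmult)
  also have "\<dots> = ennreal (exp (\<theta> * c) * ?Z + V)"
    unfolding Z V using norm_const_pos[OF \<theta>(1), where 'n = 'n] by (subst ennreal_plus) (auto simp: ennreal_mult V_def)
  finally show "(\<Sum>i. ennreal (expker \<theta> (y - ?q i))) \<le> ennreal (exp (\<theta> * c) * ?Z + V)" .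
  have "ennreal ?Z = (\<Sum>i. \<integral>\<^sup>+v. ennreal (expker \<theta> (y - (?q i + v))) * indicator unit_cube v \<partial>lborel)"
    unfolding Z[symmetric] by (rule nn_integral_tiling) measurable
  also have "\<dots> \<le> (\<Sum>i. \<integral>\<^sup>+v. ennreal (exp (\<theta> * c)) * ennreal (expker \<theta> (y - ?q i)) * indicator unit_cube v
      + indicator ?B (y - (?q i + v)) * indicator unit_cube v \<partial>lborel)"
  proof (intro suminf_le summableI nn_integral_mono)
    fix i v
    show "ennreal (expker \<theta> (y - (?q i + v))) * indicator unit_cube v \<le>
      ennreal (exp (\<theta> * c)) * ennreal (expker \<theta> (y - ?q i)) * indicator unit_cube v + indicator ?B (y - (?q i + v)) * indicator unit_cube v"
    proof (cases "v \<in> unit_cube")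
      case True
      have "ennreal (expker \<theta> (y - (?q i + v))) \<le> ennreal (exp (\<theta> * c) * expker \<theta> (y - ?q i) + indicator ?B (y - (?q i + v)))"
        by (rule ennreal_leI[OF shift2[OF True]])
      also have "\<dots> = ennreal (exp (\<theta> * c)) * ennreal (expker \<theta> (y - ?q i)) + indicator ?B (y - (?q i + v))"
        by (subst ennreal_plus) (auto simp: ennreal_mult ind expker_nonneg)
      finally show ?thesis using True by simp
    qed simp
  qed
  also have "\<dots> = (\<Sum>i. ennreal (exp (\<theta> * c)) * ennreal (expker \<theta> (y - ?q i))
      + (\<integral>\<^sup>+v. indicator ?B (y - (?q i + v)) * indicator unit_cube v \<partial>lborel))"
    by (intro suminf_cong) (subst nn_integral_add, measurable, simp only: cube)
  also have "\<dots> = ennreal (exp (\<theta> * c)) * (\<Sum>i. ennreal (expker \<theta> (y - ?q i))) + ennreal V"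
    unfolding V[symmetric] by (subst suminf_add[symmetric]) (auto simp: ennreal_suminf_cmult nn_integral_tiling[of "\<lambda>z. indicator ?B (y - z)"])
  finally show "ennreal ?Z \<le> ennreal (exp (\<theta> * c)) * (\<Sum>i. ennreal (expker \<theta> (y - ?q i))) + ennreal V" .
qed

lemma integrable_one_minus_exp:
  assumes f: "f \<in> Cc" and f0: "\<And>x. 0 \<le> f x"
  shows "integrable lborel (\<lambda>x. 1 - exp (- f x))"
proof -
  note [measurable] = Cc_borel_measurable[OF f]
  obtain n :: nat where n: "\<And>x. f x \<noteq> 0 \<Longrightarrow> norm x \<le> real n" using Cc_support f by blast
  show ?thesis
  proof (rule Bochner_Integration.integrable_bound)
    show "integrable lborel (indicator (cball 0 (real n)) :: _ \<Rightarrow> real)"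
      by (intro integrable_real_indicator emeasure_bounded_finite) auto
    show "AE x in lborel. norm (1 - exp (- f x)) \<le> norm (indicator (cball 0 (real n)) x :: real)"
    proof (rule AE_I2)
      fix x
      show "norm (1 - exp (- f x)) \<le> norm (indicator (cball 0 (real n)) x :: real)"
        using n[of x] f0[of x] by (cases "f x = 0") auto
    qed
  qed measurable
qed

lemma hit_dens_sum:
  fixes f :: "real^'n \<Rightarrow> real"
  assumes \<theta>: "0 < \<theta>" "\<theta> \<le> 1" and f: "f \<in> Cc" and f0: "\<And>x. 0 \<le> f x"
  defines "c \<equiv> real CARD('n)"
  defines "V \<equiv> measure lborel (cball (0::real^'n) (1 + 2 * c))"
  defines "U \<equiv> \<integral>x. 1 - exp (- f x) \<partial>lborel"
  defines "h \<equiv> \<lambda>i. hit f (density lborel (\<lambda>x. ennreal (dens \<theta> x))) (enum_lat i)"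
  shows "summable h" "suminf h \<le> U * (exp (\<theta> * c) + V / norm_const TYPE('n) \<theta>)"
    "U \<le> exp (\<theta> * c) * suminf h + U * V / norm_const TYPE('n) \<theta>" "h i \<le> U / norm_const TYPE('n) \<theta>"
proof -
  let ?Z = "norm_const TYPE('n) \<theta>"
  let ?q = "\<lambda>i. lat (enum_lat i) :: real^'n"
  let ?u = "\<lambda>x. 1 - exp (- f x)"
  let ?T = "\<lambda>y. \<Sum>i. ennreal (expker \<theta> (y - ?q i))"
  note [measurable] = Cc_borel_measurable[OF f]
  have Z: "0 < ?Z" by (rule norm_const_pos[OF \<theta>(1)])
  have V0: "0 \<le> V" by (simp add: V_def)
  have u: "0 \<le> ?u x" "?u x \<le> 1" for x using f0[of x] by auto
  have iu: "integrable lborel ?u" by (rule integrable_one_minus_exp[OF f f0])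
  have U0: "0 \<le> U" unfolding U_def using u by (intro Bochner_Integration.integral_nonneg) auto
  have Uc: "(\<integral>\<^sup>+y. ennreal (?u y / ?Z) * ennreal a \<partial>lborel) = ennreal (U / ?Z * a)" if "0 \<le> a" for a
  proof -
    have "(\<integral>\<^sup>+y. ennreal (?u y / ?Z) * ennreal a \<partial>lborel) = (\<integral>\<^sup>+y. ennreal (?u y / ?Z * a) \<partial>lborel)"
      using that by (intro nn_integral_cong ennreal_mult[symmetric] divide_nonneg_pos u Z)
    also have "\<dots> = ennreal (\<integral>y. ?u y / ?Z * a \<partial>lborel)"
      using that u Z iu by (intro nn_integral_eq_integral) (auto intro!: AE_I2)
    also have "(\<integral>y. ?u y / ?Z * a \<partial>lborel) = U / ?Z * a" unfolding U_def by simp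
    finally show ?thesis .
  qed
  have h0: "0 \<le> h i" for i unfolding h_def by (rule hit_nonneg[OF f0])
  have hit: "ennreal (h i) = (\<integral>\<^sup>+y. ennreal (?u y / ?Z) * ennreal (expker \<theta> (y - ?q i)) \<partial>lborel)" for i
  proof -
    have pd: "prob_density (dens \<theta> :: real^'n \<Rightarrow> real)" by (rule prob_density_dens[OF \<theta>(1)])
    note [measurable] = prob_density_measurable[OF pd]
    have d0: "0 \<le> dens \<theta> x" for x :: "real^'n" using pd by (simp add: prob_density_def)
    have "integrable lborel (\<lambda>x. dens \<theta> x * ?u (?q i + x))"
    proof (rule Bochner_Integration.integrable_bound)
      show "integrable lborel (dens \<theta> :: real^'n \<Rightarrow> real)" using pd by (simp add: prob_density_def)
      show "AE x in lborel. norm (dens \<theta> x * ?u (?q i + x)) \<le> norm (dens \<theta> x)"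
      proof (rule AE_I2)
        fix x :: "real^'n"
        have "dens \<theta> x * ?u (?q i + x) \<le> dens \<theta> x" by (intro mult_left_le u d0)
        then show "norm (dens \<theta> x * ?u (?q i + x)) \<le> norm (dens \<theta> x)" using d0[of x] u[of "?q i + x"] by (simp add: abs_mult)
      qed
    qed measurable
    then have "ennreal (h i) = (\<integral>\<^sup>+x. ennreal (dens \<theta> x * ?u (?q i + x)) \<partial>lborel)"
      unfolding h_def hit_prob_density[OF pd f] using d0 u
      by (intro nn_integral_eq_integral[symmetric]) (auto intro!: AE_I2)
    also have "\<dots> = (\<integral>\<^sup>+x. ennreal (?u (?q i + x) / ?Z) * ennreal (expker \<theta> ((?q i + x) - ?q i)) \<partial>lborel)"
    proof (intro nn_integral_cong)
      fix x :: "real^'n"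
      have "0 \<le> ?u (?q i + x) / ?Z" by (intro divide_nonneg_pos u Z)
      then show "ennreal (dens \<theta> x * ?u (?q i + x)) = ennreal (?u (?q i + x) / ?Z) * ennreal (expker \<theta> ((?q i + x) - ?q i))"
        by (subst ennreal_mult[symmetric]) (auto simp: dens_eq expker_nonneg mult.commute)
    qed
    also have "\<dots> = (\<integral>\<^sup>+y. ennreal (?u y / ?Z) * ennreal (expker \<theta> (y - ?q i)) \<partial>lborel)"
      by (rule nn_integral_lborel_shift) measurable
    finally show ?thesis .
  qed
  have sum: "(\<Sum>i. ennreal (h i)) = (\<integral>\<^sup>+y. ennreal (?u y / ?Z) * ?T y \<partial>lborel)"
  proof -
    have "(\<Sum>i. ennreal (h i)) = (\<integral>\<^sup>+y. (\<Sum>i. ennreal (?u y / ?Z) * ennreal (expker \<theta> (y - ?q i))) \<partial>lborel)"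
      unfolding hit by (rule nn_integral_suminf[symmetric]) measurable
    then show ?thesis by (simp add: ennreal_suminf_cmult)
  qed
  have upper: "(\<Sum>i. ennreal (h i)) \<le> ennreal (U / ?Z * (exp (\<theta> * c) * ?Z + V))"
  proof -
    have "(\<Sum>i. ennreal (h i)) \<le> (\<integral>\<^sup>+y. ennreal (?u y / ?Z) * ennreal (exp (\<theta> * c) * ?Z + V) \<partial>lborel)"
      unfolding sum c_def V_def by (intro nn_integral_mono mult_left_mono lattice_sum_bounds \<theta>) auto
    also have "\<dots> = ennreal (U / ?Z * (exp (\<theta> * c) * ?Z + V))" using Z V0 by (intro Uc) auto
    finally show ?thesis .
  qed
  then have fin: "(\<Sum>i. ennreal (h i)) \<noteq> top" by (rule neq_top_trans[OF ennreal_neq_top])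
  show sm: "summable h" by (rule summable_suminf_not_top[OF h0 fin])
  have S: "(\<Sum>i. ennreal (h i)) = ennreal (suminf h)" by (rule suminf_ennreal2[OF h0 sm])
  have s0: "0 \<le> suminf h" by (rule suminf_nonneg[OF sm h0])
  have "suminf h \<le> U / ?Z * (exp (\<theta> * c) * ?Z + V)"
    using upper U0 Z V0 unfolding S by (subst (asm) ennreal_le_iff) auto
  also have "\<dots> = U * (exp (\<theta> * c) + V / ?Z)" using Z by (simp add: field_simps)
  finally show "suminf h \<le> U * (exp (\<theta> * c) + V / ?Z)" .
  have "ennreal U = (\<integral>\<^sup>+y. ennreal (?u y / ?Z) * ennreal ?Z \<partial>lborel)" using Uc[of ?Z] Z by simp
  also have "\<dots> \<le> (\<integral>\<^sup>+y. ennreal (?u y / ?Z) * (ennreal (exp (\<theta> * c)) * ?T y + ennreal V) \<partial>lborel)"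
    unfolding c_def V_def by (intro nn_integral_mono mult_left_mono lattice_sum_bounds \<theta>) auto
  also have "\<dots> = (\<integral>\<^sup>+y. ennreal (exp (\<theta> * c)) * (ennreal (?u y / ?Z) * ?T y) + ennreal (?u y / ?Z) * ennreal V \<partial>lborel)"
    by (intro nn_integral_cong) (simp add: distrib_left mult_ac)
  also have "\<dots> = ennreal (exp (\<theta> * c)) * (\<integral>\<^sup>+y. ennreal (?u y / ?Z) * ?T y \<partial>lborel) + (\<integral>\<^sup>+y. ennreal (?u y / ?Z) * ennreal V \<partial>lborel)"
    by (subst nn_integral_add) (auto simp: nn_integral_cmult)
  also have "\<dots> = ennreal (exp (\<theta> * c)) * ennreal (suminf h) + ennreal (U / ?Z * V)"
    unfolding sum[symmetric] S using Uc[OF V0] by simp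
  also have "\<dots> = ennreal (exp (\<theta> * c) * suminf h + U / ?Z * V)"
    using s0 U0 Z V0 by (subst ennreal_plus) (auto simp: ennreal_mult)
  finally show "U \<le> exp (\<theta> * c) * suminf h + U * V / ?Z"
    using s0 U0 Z V0 by (subst (asm) ennreal_le_iff) auto
  have "ennreal (h i) \<le> (\<integral>\<^sup>+y. ennreal (?u y / ?Z) * ennreal 1 \<partial>lborel)"
    unfolding hit by (intro nn_integral_mono mult_left_mono ennreal_leI expker_bounds) auto
  also have "\<dots> = ennreal (U / ?Z * 1)" by (rule Uc) simp
  finally show "h i \<le> U / ?Z" using U0 Z by (subst (asm) ennreal_le_iff) auto
qed

lemma abs_one_minus_exp_le: "0 \<le> (a::real) \<Longrightarrow> \<bar>(1 - a) - exp (- a)\<bar> \<le> a\<^sup>2"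
proof -
  assume a: "0 \<le> a"
  have "1 - a \<le> exp (- a)" using exp_ge_add_one_self[of "- a"] by simp
  moreover have "exp (- a) \<le> 1 - a + a\<^sup>2"
  proof -
    have "exp (- a) = 1 / exp a" by (simp add: exp_minus inverse_eq_divide)
    also have "\<dots> \<le> 1 / (1 + a)" using exp_ge_add_one_self[of a] a by (intro divide_left_mono) auto
    also have "\<dots> \<le> 1 - a + a\<^sup>2"
    proof -
      have "(1 - a + a\<^sup>2) * (1 + a) = 1 + a ^ 3" by (simp add: algebra_simps power2_eq_square power3_eq_cube)
      then have "1 \<le> (1 - a + a\<^sup>2) * (1 + a)" using a by simp
      then show ?thesis using a by (simp add: pos_divide_le_eq)
    qed
    finally show ?thesis .
  qed
  ultimately show ?thesis by simp
qed

lemma laplace_Ptheta_near_exp: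
  fixes f :: "real^'n \<Rightarrow> real"
  assumes \<theta>: "0 < \<theta>" "\<theta> \<le> 1" and f: "f \<in> Cc" and f0: "\<And>x. 0 \<le> f x"
  defines "U \<equiv> \<integral>x. 1 - exp (- f x) \<partial>lborel"
  defines "h \<equiv> \<lambda>i. hit f (density lborel (\<lambda>x. ennreal (dens \<theta> x))) (enum_lat i)"
  shows "\<bar>(\<integral>S. exp (- pint f S) \<partial>Ptheta \<theta>) - exp (- suminf h)\<bar> \<le> U / norm_const TYPE('n) \<theta> * suminf h"
proof -
  let ?e = "U / norm_const TYPE('n) \<theta>"
  have hs: "summable h" "h i \<le> ?e" for i
    unfolding h_def U_def by (rule hit_dens_sum[OF \<theta> f f0])+
  have pd: "prob_density (dens \<theta> :: real^'n \<Rightarrow> real)" by (rule prob_density_dens[OF \<theta>(1)])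
  have h0: "0 \<le> h i" for i unfolding h_def by (rule hit_nonneg[OF f0])
  have h1: "h i \<le> 1" for i unfolding h_def by (rule hit_le_1[OF pd f f0])
  have e0: "0 \<le> ?e" using hs(2)[of 0] h0[of 0] by linarith
  have bound: "\<bar>(\<Prod>i<m. 1 - h i) - exp (- (\<Sum>i<m. h i))\<bar> \<le> ?e * suminf h" for m
  proof -
    have "\<bar>(\<Prod>i<m. 1 - h i) - (\<Prod>i<m. exp (- h i))\<bar> \<le> (\<Sum>i<m. \<bar>(1 - h i) - exp (- h i)\<bar>)"
      using norm_prod_diff[of "{..<m}" "\<lambda>i. 1 - h i" "\<lambda>i. exp (- h i)"] h0 h1 by simp
    also have "\<dots> \<le> (\<Sum>i<m. ?e * h i)"
    proof (rule sum_mono)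
      fix i
      have "\<bar>(1 - h i) - exp (- h i)\<bar> \<le> (h i)\<^sup>2" by (rule abs_one_minus_exp_le[OF h0])
      also have "\<dots> \<le> ?e * h i" unfolding power2_eq_square by (rule mult_right_mono[OF hs(2) h0])
      finally show "\<bar>(1 - h i) - exp (- h i)\<bar> \<le> ?e * h i" .
    qed
    also have "\<dots> = ?e * (\<Sum>i<m. h i)" by (simp add: sum_distrib_left)
    also have "\<dots> \<le> ?e * suminf h" using e0 h0 hs(1) by (intro mult_left_mono sum_le_suminf) auto
    finally show ?thesis by (simp add: exp_sum sum_negf[symmetric])
  qed
  have "(\<lambda>m. \<bar>(\<Prod>i<m. 1 - h i) - exp (- (\<Sum>i<m. h i))\<bar>) \<longlonglongrightarrow> \<bar>(\<integral>S. exp (- pint f S) \<partial>Ptheta \<theta>) - exp (- suminf h)\<bar>"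
    unfolding Ptheta_eq h_def
    by (intro tendsto_intros pert_laplace_density pd f f0 summable_LIMSEQ hs(1)[unfolded h_def])
  then show ?thesis using bound by (intro LIMSEQ_le_const2) auto
qed

lemma inverse_norm_const_tendsto: "((\<lambda>\<theta>. 1 / norm_const TYPE('n::finite) \<theta>) \<longlongrightarrow> 0) (at_right 0)"
proof (rule tendstoI)
  fix e :: real assume e: "0 < e"
  let ?w = "unit_ball_vol (real DIM(real^'n))"
  have w: "0 < ?w" by simp
  define R where "R = max 1 (exp 2 * 2 / (e * ?w))"
  have R: "1 \<le> R" "exp 2 * 2 / (e * ?w) \<le> R" by (auto simp: R_def)
  have "((\<lambda>\<theta>. R powr \<theta>) \<longlongrightarrow> R powr 0) (at_right 0)" using R by (intro tendsto_intros) auto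
  then have "\<forall>\<^sub>F \<theta> in at_right 0. R powr \<theta> < 2" using R by (intro order_tendstoD) auto
  moreover have "\<forall>\<^sub>F \<theta> in at_right (0::real). 0 < \<theta>" by (rule eventually_at_right_less)
  ultimately show "\<forall>\<^sub>F \<theta> in at_right 0. dist (1 / norm_const TYPE('n) \<theta>) 0 < e"
  proof eventually_elim
    case (elim \<theta>)
    have "2 / e \<le> exp (-2) * (?w * R)" using R(2) e w by (simp add: field_simps exp_minus)
    also have "\<dots> \<le> exp (- (R powr \<theta>)) * (?w * R ^ DIM(real^'n))"
      using elim R w by (intro mult_mono mult_left_mono self_le_power) auto
    also have "\<dots> \<le> norm_const TYPE('n) \<theta>" using elim R by (intro norm_const_ge) auto
    finally have "2 / e \<le> norm_const TYPE('n) \<theta>" .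
    moreover have "1 / e < 2 / e" using e by (simp add: divide_strict_right_mono)
    ultimately have "1 / e < norm_const TYPE('n) \<theta>" by linarith
    then have "1 / norm_const TYPE('n) \<theta> < e" using e norm_const_pos[OF elim(2), where 'n = 'n] by (simp add: field_simps)
    then show ?case using norm_const_pos[OF elim(2), where 'n = 'n] by simp
  qed
qed

lemma laplace_Ptheta_tendsto_0:
  fixes f :: "real^'n \<Rightarrow> real"
  assumes f: "f \<in> Cc" and f0: "\<And>x. 0 \<le> f x"
  shows "((\<lambda>\<theta>. \<integral>S. exp (- pint f S) \<partial>Ptheta \<theta>) \<longlongrightarrow> exp (- (\<integral>x. 1 - exp (- f x) \<partial>lborel))) (at_right 0)"
proof -
  define c where "c = real CARD('n)"
  define V where "V = measure lborel (cball (0::real^'n) (1 + 2 * c))"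
  define U where "U = (\<integral>x. 1 - exp (- f x) \<partial>lborel)"
  define s where "s \<theta> = (\<Sum>i. hit f (density lborel (\<lambda>x. ennreal (dens \<theta> x))) (enum_lat i))" for \<theta>
  let ?Z = "norm_const TYPE('n)"
  have Z: "((\<lambda>\<theta>. 1 / ?Z \<theta>) \<longlongrightarrow> 0) (at_right 0)" by (rule inverse_norm_const_tendsto)
  have ev: "\<forall>\<^sub>F \<theta> in at_right (0::real). 0 < \<theta> \<and> \<theta> \<le> 1"
    unfolding eventually_at_right_field by (intro exI[of _ 1]) auto
  have ex: "((\<lambda>\<theta>. exp (\<theta> * c)) \<longlongrightarrow> exp (0 * c)) (at_right 0)" "((\<lambda>\<theta>. exp (- \<theta> * c)) \<longlongrightarrow> exp (- 0 * c)) (at_right 0)"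
    by (intro tendsto_intros)+
  have s: "(s \<longlongrightarrow> U) (at_right 0)"
  proof (rule tendsto_sandwich)
    show "\<forall>\<^sub>F \<theta> in at_right 0. exp (- \<theta> * c) * (U - U * V * (1 / ?Z \<theta>)) \<le> s \<theta>"
      using ev
    proof eventually_elim
      case (elim \<theta>)
      then have "U \<le> exp (\<theta> * c) * s \<theta> + U * V / ?Z \<theta>"
        unfolding U_def s_def V_def c_def by (intro hit_dens_sum(3) f f0) auto
      then have "exp (- \<theta> * c) * (U - U * V * (1 / ?Z \<theta>)) \<le> exp (- \<theta> * c) * (exp (\<theta> * c) * s \<theta>)"
        by (intro mult_left_mono) auto
      also have "\<dots> = s \<theta>" by (simp add: exp_minus)
      finally show ?case .
    qed
    show "\<forall>\<^sub>F \<theta> in at_right 0. s \<theta> \<le> U * (exp (\<theta> * c) + V * (1 / ?Z \<theta>))"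
      using ev
    proof eventually_elim
      case (elim \<theta>)
      then have "s \<theta> \<le> U * (exp (\<theta> * c) + V / ?Z \<theta>)"
        unfolding U_def s_def V_def c_def by (intro hit_dens_sum(2) f f0) auto
      then show ?case by simp
    qed
    have "((\<lambda>\<theta>. exp (- \<theta> * c) * (U - U * V * (1 / ?Z \<theta>))) \<longlongrightarrow> exp (- 0 * c) * (U - U * V * 0)) (at_right 0)"
      by (intro tendsto_mult tendsto_diff tendsto_const ex Z)
    then show "((\<lambda>\<theta>. exp (- \<theta> * c) * (U - U * V * (1 / ?Z \<theta>))) \<longlongrightarrow> U) (at_right 0)" by simp
    have "((\<lambda>\<theta>. U * (exp (\<theta> * c) + V * (1 / ?Z \<theta>))) \<longlongrightarrow> U * (exp (0 * c) + V * 0)) (at_right 0)"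
      by (intro tendsto_mult tendsto_add tendsto_const ex Z)
    then show "((\<lambda>\<theta>. U * (exp (\<theta> * c) + V * (1 / ?Z \<theta>))) \<longlongrightarrow> U) (at_right 0)" by simp
  qed
  have "((\<lambda>\<theta>. (\<integral>S. exp (- pint f S) \<partial>Ptheta \<theta>) - exp (- s \<theta>)) \<longlongrightarrow> 0) (at_right 0)"
  proof (rule Lim_null_comparison)
    show "\<forall>\<^sub>F \<theta> in at_right 0. norm ((\<integral>S. exp (- pint f S) \<partial>Ptheta \<theta>) - exp (- s \<theta>)) \<le> U * (1 / ?Z \<theta>) * s \<theta>"
      using ev
    proof eventually_elim
      case (elim \<theta>)
      then show ?case using laplace_Ptheta_near_exp[of \<theta> f] f f0 unfolding U_def s_def by simp
    qed
    have "((\<lambda>\<theta>. U * (1 / ?Z \<theta>) * s \<theta>) \<longlongrightarrow> U * 0 * U) (at_right 0)"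
      by (intro tendsto_mult tendsto_const Z s)
    then show "((\<lambda>\<theta>. U * (1 / ?Z \<theta>) * s \<theta>) \<longlongrightarrow> 0) (at_right 0)" by simp
  qed
  from tendsto_add[OF this tendsto_exp[OF tendsto_minus[OF s]]]
  show ?thesis unfolding U_def by simp
qed

section \<open>The Poisson process\<close>

abbreviation unif_cube :: "(real^'n) measure" where
  "unif_cube \<equiv> uniform_measure lborel unit_cube"

abbreviation poisson_counts :: "(int^'n \<Rightarrow> nat) measure" where
  "poisson_counts \<equiv> PiM UNIV (\<lambda>_. measure_pmf (poisson_pmf 1))"

abbreviation cube_points :: "((int^'n) \<times> nat \<Rightarrow> real^'n) measure" where
  "cube_points \<equiv> PiM UNIV (\<lambda>_. unif_cube)"

lemma unif_cube_eq: "unif_cube = density lborel (\<lambda>x::real^'n. ennreal (indicator unit_cube x))"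
proof -
  have "indicator unit_cube x / emeasure lborel (unit_cube :: (real^'n) set) = ennreal (indicator unit_cube x)" for x :: "real^'n"
    by (simp add: emeasure_unit_cube divide_ennreal_def indicator_def)
  then show ?thesis by (simp add: uniform_measure_def)
qed

lemma prob_density_unit_cube: "prob_density (indicator unit_cube :: real^'n \<Rightarrow> real)"
  unfolding prob_density_def using emeasure_unit_cube[where 'n = 'n]
  by (auto simp: measure_def intro!: integrable_real_indicator)

lemma prob_space_unif_cube: "prob_space (unif_cube :: (real^'n) measure)"
  unfolding unif_cube_eq by (rule prob_space_prob_density[OF prob_density_unit_cube])

lemma poisson_cfg_measurable:
  "poisson_cfg \<in> poisson_counts \<Otimes>\<^sub>M cube_points \<rightarrow>\<^sub>M (XiM :: (real^'n) set measure)"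
proof -
  let ?M = "poisson_counts \<Otimes>\<^sub>M (cube_points :: ((int^'n) \<times> nat \<Rightarrow> real^'n) measure)"
  let ?r = "from_nat :: nat \<Rightarrow> (int^'n) \<times> nat"
  let ?x = "\<lambda>i (\<omega> :: (int^'n \<Rightarrow> nat) \<times> ((int^'n) \<times> nat \<Rightarrow> real^'n)). lat (fst (?r i)) + snd \<omega> (?r i)"
  let ?A = "\<lambda>i (\<omega> :: (int^'n \<Rightarrow> nat) \<times> ((int^'n) \<times> nat \<Rightarrow> real^'n)). snd (?r i) < fst \<omega> (fst (?r i))"
  have "poisson_cfg \<omega> = to_Xi {?x i \<omega> | i. ?A i \<omega>}" for \<omega> :: "(int^'n \<Rightarrow> nat) \<times> ((int^'n) \<times> nat \<Rightarrow> real^'n)"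
  proof -
    have "{lat q + snd \<omega> (q, j) | q j. j < fst \<omega> q} = {?x i \<omega> | i. ?A i \<omega>}"
    proof
      show "{lat q + snd \<omega> (q, j) | q j. j < fst \<omega> q} \<subseteq> {?x i \<omega> | i. ?A i \<omega>}"
      proof
        fix y assume "y \<in> {lat q + snd \<omega> (q, j) | q j. j < fst \<omega> q}"
        then obtain q j where "y = lat q + snd \<omega> (q, j)" "j < fst \<omega> q" by blast
        then have "y = ?x (to_nat (q, j)) \<omega> \<and> ?A (to_nat (q, j)) \<omega>" by simp
        then show "y \<in> {?x i \<omega> | i. ?A i \<omega>}" by blast
      qed
      show "{?x i \<omega> | i. ?A i \<omega>} \<subseteq> {lat q + snd \<omega> (q, j) | q j. j < fst \<omega> q}"
      proof
        fix y assume "y \<in> {?x i \<omega> | i. ?A i \<omega>}"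
        then obtain i where "y = ?x i \<omega>" "?A i \<omega>" by blast
        then have "y = lat (fst (?r i)) + snd \<omega> (fst (?r i), snd (?r i)) \<and> snd (?r i) < fst \<omega> (fst (?r i))" by simp
        then show "y \<in> {lat q + snd \<omega> (q, j) | q j. j < fst \<omega> q}" by blast
      qed
    qed
    then show ?thesis by (simp add: poisson_cfg_def case_prod_beta)
  qed
  moreover have "(\<lambda>\<omega>. to_Xi {?x i \<omega> | i. ?A i \<omega>}) \<in> ?M \<rightarrow>\<^sub>M XiM"
  proof (rule measurable_config)
    fix i
    have [measurable]: "(\<lambda>\<omega>. snd \<omega> (?r i)) \<in> ?M \<rightarrow>\<^sub>M borel"
      using measurable_compose[OF measurable_snd measurable_component_singleton[of "?r i" UNIV "\<lambda>_. unif_cube"]]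
      by (simp cong: measurable_cong_sets)
    have [measurable]: "(\<lambda>\<omega>. fst \<omega> (fst (?r i))) \<in> ?M \<rightarrow>\<^sub>M count_space UNIV"
      using measurable_compose[OF measurable_fst measurable_component_singleton[of "fst (?r i)" UNIV "\<lambda>_. measure_pmf (poisson_pmf 1)"]]
      by (simp cong: measurable_cong_sets)
    show "?x i \<in> borel_measurable ?M" by measurable
    show "Measurable.pred ?M (?A i)" by measurable
  qed
  ultimately show ?thesis by presburger
qed

lemma prob_space_poisson_base:
  "prob_space ((poisson_counts :: (int^'n \<Rightarrow> nat) measure) \<Otimes>\<^sub>M (cube_points :: ((int^'n) \<times> nat \<Rightarrow> real^'n) measure))"
proof -
  interpret A: prob_space "poisson_counts :: (int^'n \<Rightarrow> nat) measure"
    by (rule prob_space_PiM) (rule measure_pmf.prob_space_axioms)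
  interpret B: prob_space "cube_points :: ((int^'n) \<times> nat \<Rightarrow> real^'n) measure"
    by (rule prob_space_PiM) (rule prob_space_unif_cube)
  interpret pair_prob_space "poisson_counts :: (int^'n \<Rightarrow> nat) measure" "cube_points :: ((int^'n) \<times> nat \<Rightarrow> real^'n) measure" ..
  show ?thesis by (rule P.prob_space_axioms)
qed

lemma prob_Xi_Pzero: "prob_Xi (Pzero :: (real^'n) set measure)"
  unfolding prob_Xi_def Pzero_def
  by (auto intro!: prob_space.prob_space_distr prob_space_poisson_base poisson_cfg_measurable)

lemma integral_poisson_power:
  assumes c: "0 \<le> c" "c \<le> (1::real)"
  shows "(\<integral>k. c ^ k \<partial>measure_pmf (poisson_pmf 1)) = exp (c - 1)"
proof -
  have sums: "(\<lambda>k. pmf (poisson_pmf 1) k * c ^ k) sums (exp (-1) * exp c)"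
  proof -
    have "(\<lambda>k. exp (-1) * (c ^ k /\<^sub>R fact k)) sums (exp (-1) * exp c)"
      by (intro sums_mult exp_converges)
    then show ?thesis by (simp add: field_simps)
  qed
  have "(\<integral>k. c ^ k \<partial>measure_pmf (poisson_pmf 1)) = (\<integral>k. pmf (poisson_pmf 1) k * c ^ k \<partial>count_space UNIV)"
    unfolding measure_pmf_eq_density by (subst integral_density) auto
  also have "\<dots> = (\<Sum>k. pmf (poisson_pmf 1) k * c ^ k)"
  proof (rule integral_count_space_nat)
    have "summable (\<lambda>k. norm (pmf (poisson_pmf 1) k * c ^ k))"
      using sums_summable[OF sums] c by (simp add: abs_mult)
    then show "integrable (count_space UNIV) (\<lambda>k. pmf (poisson_pmf 1) k * c ^ k)"
      by (simp add: integrable_count_space_nat_iff)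
  qed
  also have "\<dots> = exp (-1) * exp c" using sums_unique[OF sums] by simp
  also have "\<dots> = exp (c - 1)" by (simp add: mult_exp_exp)
  finally show ?thesis .
qed

lemma AE_cube_points_in_cube:
  "AE U in (cube_points :: ((int^'n) \<times> nat \<Rightarrow> real^'n) measure). \<forall>p. U p \<in> unit_cube"
proof -
  have AE1: "AE v in (unif_cube :: (real^'n) measure). v \<in> unit_cube"
    unfolding unif_cube_eq by (subst AE_density) (auto simp: indicator_def)
  have "AE U in (cube_points :: ((int^'n) \<times> nat \<Rightarrow> real^'n) measure). U p \<in> unit_cube" for p
    by (rule AE_PiM_component[OF prob_space_unif_cube _ AE1]) simp
  then show ?thesis by (intro AE_all_countable[THEN iffD2] allI)
qed

lemma AE_cube_points_inj:
  "AE U in (cube_points :: ((int^'n) \<times> nat \<Rightarrow> real^'n) measure). inj (\<lambda>p. lat (fst p) + U p)"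
proof -
  let ?M = "cube_points :: ((int^'n) \<times> nat \<Rightarrow> real^'n) measure"
  have "AE U in ?M. p \<noteq> p' \<longrightarrow> lat (fst p) + U p \<noteq> lat (fst p') + U p'" for p p'
  proof (cases "p = p'")
    case False
    have "AE U in ?M. U p' \<noteq> lat (fst p) + U p - lat (fst p')"
    proof (rule AE_PiM_neq[where h = "\<lambda>y. lat (fst p) + y - lat (fst p')" and M = "\<lambda>_. unif_cube", OF prob_space_unif_cube False])
      show "emeasure unif_cube {x} = 0" for x :: "real^'n"
        unfolding unif_cube_eq by (rule density_singleton_null) measurable
    qed auto
    then show ?thesis by eventually_elim (auto simp: algebra_simps)
  qed simp
  then have "AE U in ?M. \<forall>p p'. p \<noteq> p' \<longrightarrow> lat (fst p) + U p \<noteq> lat (fst p') + U p'"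
    by (intro AE_all_countable[THEN iffD2] allI)
  then show ?thesis by eventually_elim (auto simp: inj_def)
qed

lemma pint_poisson_cfg:
  fixes U :: "(int^'n) \<times> nat \<Rightarrow> real^'n"
  assumes cube: "\<And>p. U p \<in> unit_cube" and inj: "inj (\<lambda>p. lat (fst p) + U p)"
    and f: "\<And>x. f x \<noteq> 0 \<Longrightarrow> norm x \<le> real n"
  shows "pint f (poisson_cfg (N, U)) =
    (\<Sum>p\<in>Sigma {q::int^'n. norm (lat q + 0) \<le> real (n + CARD('n))} (\<lambda>q. {..<N q}). f (lat (fst p) + U p))"
proof -
  let ?S = "{lat q + U (q, j) | q j. j < N q}"
  let ?J = "\<lambda>n. Sigma {q::int^'n. norm (lat q + 0) \<le> real (n + CARD('n))} (\<lambda>q. {..<N q})"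
  let ?x = "\<lambda>p. lat (fst p) + U p"
  have fin: "finite (?J n)" for n using card_lat_cball(1)[of "0::real^'n" "n + CARD('n)"] by (intro finite_SigmaI) auto
  have sub: "?S \<inter> cball 0 (real n) \<subseteq> ?x ` ?J n" for n
  proof
    fix y assume "y \<in> ?S \<inter> cball 0 (real n)"
    then obtain q j where y: "y = lat q + U (q, j)" "j < N q" "norm y \<le> real n" by auto
    have "norm (lat q) \<le> norm y + norm (U (q, j))" using norm_triangle_ineq4[of y "U (q, j)"] y(1) by simp
    also have "\<dots> \<le> real n + real CARD('n)" using y(3) norm_unit_cube_le[OF cube] by (intro add_mono) auto
    finally have "(q, j) \<in> ?J n" using y(2) by simp
    then show "y \<in> ?x ` ?J n" using y(1) by (intro image_eqI[of _ _ "(q, j)"]) auto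
  qed
  have S: "?S \<in> Xi"
    by (rule XiI_cball) (rule finite_subset[OF sub finite_imageI[OF fin]])
  have "pint f (poisson_cfg (N, U)) = sum f {y \<in> ?S. f y \<noteq> 0}"
    using S by (simp add: poisson_cfg_def to_Xi_def pint_def)
  also have "\<dots> = sum f (?x ` ?J n)"
  proof (rule sum.mono_neutral_left)
    show "finite (?x ` ?J n)" using fin by simp
    show "{y \<in> ?S. f y \<noteq> 0} \<subseteq> ?x ` ?J n"
    proof
      fix y assume "y \<in> {y \<in> ?S. f y \<noteq> 0}"
      then have "y \<in> ?S \<inter> cball 0 (real n)" using f[of y] by simp
      then show "y \<in> ?x ` ?J n" using sub by blast
    qed
    show "\<forall>y\<in>?x ` ?J n - {y \<in> ?S. f y \<noteq> 0}. f y = 0"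
    proof
      fix y assume y: "y \<in> ?x ` ?J n - {y \<in> ?S. f y \<noteq> 0}"
      then obtain q j where "j < N q" "y = lat q + U (q, j)" by auto
      then have "y \<in> ?S" by blast
      then show "f y = 0" using y by blast
    qed
  qed
  also have "\<dots> = (\<Sum>p\<in>?J n. f (?x p))" by (rule sum.reindex[OF inj_on_subset[OF inj], unfolded o_def]) simp
  finally show ?thesis .
qed

lemma sum_hit_unif_cube:
  fixes f :: "real^'n \<Rightarrow> real"
  assumes f: "f \<in> Cc" and f0: "\<And>x. 0 \<le> f x" and supp: "\<And>x. f x \<noteq> 0 \<Longrightarrow> norm x \<le> real n"
  shows "(\<Sum>q | norm (lat q + 0) \<le> real (n + CARD('n)). hit f unif_cube (q::int^'n)) = (\<integral>x. 1 - exp (- f x) \<partial>lborel)"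
proof -
  let ?F = "{q::int^'n. norm (lat q + 0) \<le> real (n + CARD('n))}"
  let ?u = "\<lambda>x. 1 - exp (- f x)"
  note [measurable] = Cc_borel_measurable[OF f]
  have fin: "finite ?F" by (rule card_lat_cball)
  have u: "0 \<le> ?u x" for x using f0[of x] by simp
  have hit: "hit f unif_cube q = (\<integral>v. indicator unit_cube v * ?u (lat q + v) \<partial>lborel)" for q :: "int^'n"
    unfolding unif_cube_eq by (rule hit_prob_density[OF prob_density_unit_cube f])
  have h0: "0 \<le> hit f unif_cube q" for q :: "int^'n" by (rule hit_nonneg[OF f0])
  have nn: "(\<integral>\<^sup>+v. ennreal (?u (lat q + v)) * indicator unit_cube v \<partial>lborel) = ennreal (hit f unif_cube q)" for q :: "int^'n"
  proof -
    have "integrable lborel (\<lambda>v. indicator unit_cube v * ?u (lat q + v))"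
    proof (rule Bochner_Integration.integrable_bound)
      show "integrable lborel (indicator unit_cube :: real^'n \<Rightarrow> real)"
        using prob_density_unit_cube[where 'n = 'n] by (simp add: prob_density_def)
      show "AE v in lborel. norm (indicator unit_cube v * ?u (lat q + v)) \<le> norm (indicator unit_cube v :: real)"
        using f0 by (intro AE_I2) (auto simp: indicator_def)
    qed measurable
    then have "ennreal (hit f unif_cube q) = (\<integral>\<^sup>+v. ennreal (indicator unit_cube v * ?u (lat q + v)) \<partial>lborel)"
      unfolding hit using u by (intro nn_integral_eq_integral[symmetric]) (auto intro!: AE_I2)
    also have "\<dots> = (\<integral>\<^sup>+v. ennreal (?u (lat q + v)) * indicator unit_cube v \<partial>lborel)"
      by (intro nn_integral_cong) (auto simp: indicator_def)
    finally show ?thesis ..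
  qed
  have zero: "hit f unif_cube q = 0" if q: "q \<notin> ?F" for q :: "int^'n"
  proof -
    have z: "indicator unit_cube v * ?u (lat q + v) = 0" for v :: "real^'n"
    proof (cases "v \<in> unit_cube")
      case True
      have "norm (lat q) \<le> norm (lat q + v) + norm v" using norm_triangle_ineq4[of "lat q + v" v] by simp
      then have "\<not> norm (lat q + v) \<le> real n" using q norm_unit_cube_le[OF True] by auto
      then have "f (lat q + v) = 0" using supp by blast
      then show ?thesis by simp
    qed simp
    show ?thesis unfolding hit z by simp
  qed
  have "ennreal (\<integral>x. ?u x \<partial>lborel) = (\<integral>\<^sup>+x. ennreal (?u x) \<partial>lborel)"
    using u by (intro nn_integral_eq_integral[symmetric] integrable_one_minus_exp f f0) auto
  also have "\<dots> = (\<Sum>i. ennreal (hit f unif_cube (enum_lat i)))"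
    unfolding nn[symmetric] by (rule nn_integral_tiling) measurable
  also have "\<dots> = (\<Sum>i\<in>enum_lat -` ?F. ennreal (hit f unif_cube (enum_lat i)))"
    by (rule suminf_finite[OF finite_vimageI[OF fin inj_enum_lat]]) (use zero in auto)
  also have "\<dots> = (\<Sum>q\<in>?F. ennreal (hit f unif_cube q))"
    by (rule sum.reindex_bij_betw)
      (simp add: bij_betw_def inj_on_subset[OF inj_enum_lat] bij_is_surj[OF bij_enum_lat] del: vimage_Collect_eq)
  also have "\<dots> = ennreal (\<Sum>q\<in>?F. hit f unif_cube q)" using h0 by simp
  finally show ?thesis
    using h0 u by (subst (asm) ennreal_inj) (auto intro!: sum_nonneg Bochner_Integration.integral_nonneg)
qed

lemma laplace_Pzero:
  fixes f :: "real^'n \<Rightarrow> real"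
  assumes f: "f \<in> Cc" and f0: "\<And>x. 0 \<le> f x"
  shows "(\<integral>S. exp (- pint f S) \<partial>Pzero) = exp (- (\<integral>x. 1 - exp (- f x) \<partial>lborel))"
proof -
  obtain n :: nat where supp: "\<And>x. f x \<noteq> 0 \<Longrightarrow> norm x \<le> real n" using Cc_support f by blast
  let ?F = "{q::int^'n. norm (lat q + 0) \<le> real (n + CARD('n))}"
  let ?A = "poisson_counts :: (int^'n \<Rightarrow> nat) measure"
  let ?B = "cube_points :: ((int^'n) \<times> nat \<Rightarrow> real^'n) measure"
  define c where "c q = 1 - hit f unif_cube q" for q :: "int^'n"
  note [measurable] = Cc_borel_measurable[OF f] pint_measurable[OF f] poisson_cfg_measurable
  interpret cube: prob_space "unif_cube :: (real^'n) measure" by (rule prob_space_unif_cube)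
  interpret A: prob_space ?A by (rule prob_space_PiM) (rule measure_pmf.prob_space_axioms)
  interpret B: prob_space ?B by (rule prob_space_PiM) (rule prob_space_unif_cube)
  interpret AB: pair_prob_space ?A ?B ..
  have fin: "finite ?F" by (rule card_lat_cball)
  have int: "integrable unif_cube (\<lambda>v. exp (- f (lat q + v)))" for q :: "int^'n"
    by (rule cube.integrable_const_bound[of _ 1]) (auto simp: f0)
  have c: "(\<integral>v. exp (- f (lat q + v)) \<partial>unif_cube) = c q" for q
    unfolding c_def hit_def using int cube.prob_space by simp
  have c01: "0 \<le> c q" "c q \<le> 1" for q
    using hit_le_1[OF prob_density_unit_cube f f0, of q] hit_nonneg[of f unif_cube q, OF f0]
    unfolding c_def unif_cube_eq by auto
  have inner: "(\<integral>U. exp (- pint f (poisson_cfg (N, U))) \<partial>?B) = (\<Prod>q\<in>?F. c q ^ N q)" for N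
  proof -
    let ?J = "Sigma ?F (\<lambda>q. {..<N q})"
    have "(\<integral>U. exp (- pint f (poisson_cfg (N, U))) \<partial>?B) = (\<integral>U. (\<Prod>p\<in>?J. exp (- f (lat (fst p) + U p))) \<partial>?B)"
    proof (rule integral_cong_AE)
      have "N \<in> space ?A" by (simp add: space_PiM)
      then have [measurable]: "(\<lambda>U. poisson_cfg (N, U)) \<in> ?B \<rightarrow>\<^sub>M XiM"
        by (rule measurable_compose[OF measurable_Pair1' poisson_cfg_measurable])
      show "(\<lambda>U. exp (- pint f (poisson_cfg (N, U)))) \<in> borel_measurable ?B" by measurable
      show "(\<lambda>U. \<Prod>p\<in>?J. exp (- f (lat (fst p) + U p))) \<in> borel_measurable ?B" by measurable
      show "AE U in ?B. exp (- pint f (poisson_cfg (N, U))) = (\<Prod>p\<in>?J. exp (- f (lat (fst p) + U p)))"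
        using AE_cube_points_in_cube AE_cube_points_inj
      proof eventually_elim
        case (elim U)
        have "pint f (poisson_cfg (N, U)) = (\<Sum>p\<in>?J. f (lat (fst p) + U p))"
          using elim by (intro pint_poisson_cfg supp) auto
        then show ?case using fin by (simp add: exp_sum sum_negf[symmetric])
      qed
    qed
    also have "\<dots> = (\<Prod>p\<in>?J. \<integral>v. exp (- f (lat (fst p) + v)) \<partial>unif_cube)"
      by (rule integral_PiM_prod) (use fin int prob_space_unif_cube in auto)
    also have "\<dots> = (\<Prod>p\<in>?J. c (fst p))" by (simp add: c)
    also have "\<dots> = (\<Prod>q\<in>?F. \<Prod>j<N q. c q)" using fin by (subst prod.Sigma) (auto simp: case_prod_beta)
    finally show ?thesis by simp
  qed
  have "(\<integral>S. exp (- pint f S) \<partial>Pzero) = (\<integral>\<omega>. exp (- pint f (poisson_cfg \<omega>)) \<partial>(?A \<Otimes>\<^sub>M ?B))"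
    unfolding Pzero_def by (rule integral_distr) measurable
  also have "\<dots> = (\<integral>N. \<integral>U. exp (- pint f (poisson_cfg (N, U))) \<partial>?B \<partial>?A)"
  proof (rule AB.integral_fst'[symmetric])
    show "integrable (?A \<Otimes>\<^sub>M ?B) (\<lambda>\<omega>. exp (- pint f (poisson_cfg \<omega>)))"
      by (rule AB.P.integrable_const_bound[of _ 1]) (auto simp: pint_nonneg f0)
  qed
  also have "\<dots> = (\<integral>N. (\<Prod>q\<in>?F. c q ^ N q) \<partial>?A)" by (simp add: inner)
  also have "\<dots> = (\<Prod>q\<in>?F. \<integral>k. c q ^ k \<partial>measure_pmf (poisson_pmf 1))"
  proof (rule integral_PiM_prod)
    show "integrable (measure_pmf (poisson_pmf 1)) ((^) (c q))" for q
      by (rule measure_pmf.integrable_const_bound[of _ 1]) (use c01 in \<open>auto simp: power_le_one\<close>)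
  qed (use fin in \<open>auto intro: measure_pmf.prob_space_axioms\<close>)
  also have "\<dots> = (\<Prod>q\<in>?F. exp (- hit f unif_cube q))"
    using c01 by (simp add: integral_poisson_power) (simp add: c_def)
  also have "\<dots> = exp (- (\<Sum>q\<in>?F. hit f unif_cube q))" using fin by (simp add: exp_sum sum_negf[symmetric])
  also have "(\<Sum>q\<in>?F. hit f unif_cube q) = (\<integral>x. 1 - exp (- f x) \<partial>lborel)"
    by (rule sum_hit_unif_cube[OF f f0 supp])
  finally show ?thesis .
qed

theorem theorem8:
  shows "weak_conv_Xi (Ptheta :: real \<Rightarrow> (real^'n) set measure) Pinf at_top
       \<and> weak_conv_Xi (Ptheta :: real \<Rightarrow> (real^'n) set measure) Pzero (at_right 0)"
proof
  show "weak_conv_Xi (Ptheta :: real \<Rightarrow> (real^'n) set measure) Pinf at_top" by (rule Ptheta_tendsto_Pinf)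
  show "weak_conv_Xi (Ptheta :: real \<Rightarrow> (real^'n) set measure) Pzero (at_right 0)"
  proof (rule weak_conv_XiI_laplace)
    show "\<forall>\<^sub>F \<theta> in at_right 0. prob_Xi (Ptheta \<theta> :: (real^'n) set measure)"
      using eventually_at_right_less[of 0] by eventually_elim (rule prob_Xi_Ptheta)
    show "prob_Xi (Pzero :: (real^'n) set measure)" by (rule prob_Xi_Pzero)
    show "((\<lambda>\<theta>. \<integral>S. exp (- pint f S) \<partial>Ptheta \<theta>) \<longlongrightarrow> (\<integral>S. exp (- pint f S) \<partial>Pzero)) (at_right 0)"
      if "f \<in> Cc" "\<And>x. 0 \<le> f x" for f :: "real^'n \<Rightarrow> real"
      unfolding laplace_Pzero[OF that] by (rule laplace_Ptheta_tendsto_0[OF that])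
  qed
qed

end
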